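(* Let $(V,\mathcal{C},I,\sigma)$ be an instance with $n=|V|$ and $q=|I|$, and let $\rho$ be a volume function on $2^V$. Given access to the oracles $\mathrm{L}_1$, $\mathrm{L}_2$ and to the test "$\rho(X)>0$?", all $\rho$-positive solutions in $\mathcal{S}$ can be enumerated with delay $$O\big((n+q)q\,\delta(V)\,\theta_{1,\mathrm{t}}+q\,\theta_{2,\mathrm{t}}+q\,\delta(V)\,\theta_{\rho,\mathrm{t}}+(n^2+nq)q\,\delta(V)\big)$$ and in space $$O\big(n\theta_{1,\mathrm{s}}+n\theta_{2,\mathrm{s}}+n\theta_{\rho,\mathrm{s}}+(n+q)n\big).$$
   Context: A set system $(V,\mathcal{C})$ consists of a finite set $V$ of $n\ge 1$ elements and a family $\mathcal{C}\subseteq 2^V$, whose members are called components. No further structural assumption is made on $\mathcal{C}$. For $X\subseteq V$, a component $Z\subseteq X$ is $X$-maximal if no component $W$ satisfies $Z\subsetneq W\subseteq X$. We write $\mathcal{C}_{\max}(X)$ for the family of $X$-maximal components. For $X\subseteq Y\subseteq V$, we write $\mathcal{C}_{\max}(X;Y)=\{C\in\mathcal{C}_{\max}(Y): X\subseteq C\}$. An instance is a tuple $(V,\mathcal{C},I,\sigma)$, where $(V,\mathcal{C})$ is a set system, $I$ is a set of $q\ge1$ items, and $\sigma:V\to 2^I$. For $X\subseteq V$, let $I_\sigma(X)=\bigcap_{v\in X}\sigma(v)$. A solution is a component $X\in\mathcal{C}$ such that every component $Y\supsetneq X$ satisfies $I_\sigma(Y)\subsetneq I_\sigma(X)$. We write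 $\mathcal{S}$ for the family of all solutions. The system is accessed only through two oracles. - Given non-empty $X\subseteq Y\subseteq V$, the oracle $\mathrm{L}_1(X,Y)$ returns some component in $\mathcal{C}_{\max}(X;Y)$, or $\emptyset$ if none exists. It runs in $\theta_{1,\mathrm{t}}$ time and $\theta_{1,\mathrm{s}}$ space. - Given non-empty $Y\subseteq V$, the oracle $\mathrm{L}_2(Y)$ returns $\mathcal{C}_{\max}(Y)$. It runs in $\theta_{2,\mathrm{t}}$ time and $\theta_{2,\mathrm{s}}$ space. A volume function is a map $\rho:2^V\to\mathbb{R}$ with $\rho(X)\le\rho(Y)$ whenever $X\subseteq Y$. A set $X$ is $\rho$-positive if $\rho(X)>0$. Whether $\rho(X)>0$ can be tested in $\theta_{\rho,\mathrm{t}}$ time and $\theta_{\rho,\mathrm{s}}$ space. $\delta(X)$ denotes an upper bound on $|\mathcal{C}_{\max}(X)|$, with $\delta(Y)\le\delta(X)$ whenever $Y\subseteq X$. The delay of an enumeration algorithm is the maximum of the preprocessing time, the time between consecutive outputs, and the postprocessing time.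
   Formalization: The empty set is never output (if ∅ is a component, the oracles, which take only non-empty arguments, cannot in general reveal it, so the literal claim fails), and δ(V) ≥ 1 is assumed, since δ(V)=0 forces 𝒞 to be empty and makes the delay bound degenerate. *)

theory Defs
  imports Complex_Main
begin

section \<open>Set systems, instances and solutions\<close>

definition max_components :: "'v set set \<Rightarrow> 'v set \<Rightarrow> 'v set set" where
  "max_components C X = {Z \<in> C. Z \<subseteq> X \<and> \<not> (\<exists>W\<in>C. Z \<subset> W \<and> W \<subseteq> X)}"

definition max_components_between :: "'v set set \<Rightarrow> 'v set \<Rightarrow> 'v set \<Rightarrow> 'v set set" where
  "max_components_between C X Y = {Z \<in> max_components C Y. X \<subseteq> Z}"

definition set_system :: "'v set \<Rightarrow> 'v set set \<Rightarrow> bool" where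
  "set_system V C \<longleftrightarrow> finite V \<and> V \<noteq> {} \<and> C \<subseteq> Pow V"

definition is_instance :: "'v set \<Rightarrow> 'v set set \<Rightarrow> 'i set \<Rightarrow> ('v \<Rightarrow> 'i set) \<Rightarrow> bool" where
  "is_instance V C I \<sigma> \<longleftrightarrow>
     set_system V C \<and> finite I \<and> I \<noteq> {} \<and> (\<forall>v\<in>V. \<sigma> v \<subseteq> I)"

text \<open>The intersection with \<open>I\<close> only matters for \<open>X = {}\<close>, where the empty intersection is \<open>I\<close>.\<close>

definition common_items :: "'i set \<Rightarrow> ('v \<Rightarrow> 'i set) \<Rightarrow> 'v set \<Rightarrow> 'i set" where
  "common_items I \<sigma> X = I \<inter> (\<Inter>v\<in>X. \<sigma> v)"

definition solutions :: "'v set set \<Rightarrow> 'i set \<Rightarrow> ('v \<Rightarrow> 'i set) \<Rightarrow> 'v set set" where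
  "solutions C I \<sigma> =
     {X \<in> C. \<forall>Y\<in>C. X \<subset> Y \<longrightarrow> common_items I \<sigma> Y \<subset> common_items I \<sigma> X}"

definition volume_function :: "'v set \<Rightarrow> ('v set \<Rightarrow> real) \<Rightarrow> bool" where
  "volume_function V \<rho> \<longleftrightarrow> (\<forall>X Y. X \<subseteq> Y \<and> Y \<subseteq> V \<longrightarrow> \<rho> X \<le> \<rho> Y)"

definition component_bound :: "'v set \<Rightarrow> 'v set set \<Rightarrow> ('v set \<Rightarrow> nat) \<Rightarrow> bool" where
  "component_bound V C \<delta> \<longleftrightarrow>
     (\<forall>X\<subseteq>V. card (max_components C X) \<le> \<delta> X) \<and>
     (\<forall>X Y. Y \<subseteq> X \<and> X \<subseteq> V \<longrightarrow> \<delta> Y \<le> \<delta> X)"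

definition is_L1 :: "'v set \<Rightarrow> 'v set set \<Rightarrow> ('v set \<Rightarrow> 'v set \<Rightarrow> 'v set) \<Rightarrow> bool" where
  "is_L1 V C l1 \<longleftrightarrow>
     (\<forall>X Y. X \<noteq> {} \<and> X \<subseteq> Y \<and> Y \<subseteq> V \<longrightarrow>
        (if max_components_between C X Y = {} then l1 X Y = {}
         else l1 X Y \<in> max_components_between C X Y))"

definition is_L2 :: "'v set \<Rightarrow> 'v set set \<Rightarrow> ('v set \<Rightarrow> 'v set list) \<Rightarrow> bool" where
  "is_L2 V C l2 \<longleftrightarrow>
     (\<forall>Y. Y \<noteq> {} \<and> Y \<subseteq> V \<longrightarrow> distinct (l2 Y) \<and> set (l2 Y) = max_components C Y)"


section \<open>A word RAM with oracles\<close>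

text \<open>
  Programs work on numbered scalar registers and numbered arrays of machine words. A subset of
  \<open>V\<close> is held as a bit vector in the cells \<open>0, \<dots>, n - 1\<close> of an array. Syntax does not mention
  the instance, so one program serves all instances.
\<close>

datatype binop = Add | Sub | Mul | Less | Equal

datatype expr =
    Num nat
  | Reg nat
  | Load nat expr              \<comment> \<open>array, index\<close>
  | Bin binop expr expr

datatype com =
    Skip
  | Assign nat expr            \<comment> \<open>register, value\<close>
  | Store nat expr expr        \<comment> \<open>array, index, value\<close>
  | Seq com com
  | If expr com com
  | While expr com
  | CallL1 nat nat nat         \<comment> \<open>arrays holding \<open>X\<close> and \<open>Y\<close>, array for the answer\<close>
  | CallL2 expr nat            \<comment> \<open>answer buffer, array holding \<open>Y\<close>\<close>
  | Fetch nat expr nat         \<comment> \<open>register for success flag, answer buffer, target array\<close>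
  | TestPositive nat nat       \<comment> \<open>register for the answer, array holding \<open>X\<close>\<close>
  | Output nat                 \<comment> \<open>array holding the output set\<close>

text \<open>
  The answer of the second oracle, a whole family, stays in an answer buffer, from which its
  members are moved one by one into working arrays; calling the oracle again on the same buffer
  discards what is left there.
\<close>

record 'v state =
  regs :: "nat \<Rightarrow> nat"
  arrs :: "nat \<Rightarrow> nat \<Rightarrow> nat"
  bufs :: "nat \<Rightarrow> 'v set list"
  clock :: nat
  outs :: "(nat \<times> 'v set) list"   \<comment> \<open>outputs in chronological order, with their times\<close>

record 'v machine =
  num :: nat                        \<comment> \<open>\<open>n\<close>, the length of bit vectors\<close>
  elem :: "nat \<Rightarrow> 'v"              \<comment> \<open>numbering of \<open>V\<close> by \<open>0, \<dots>, n - 1\<close>\<close>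
  oracle1 :: "'v set \<Rightarrow> 'v set \<Rightarrow> 'v set"
  oracle2 :: "'v set \<Rightarrow> 'v set list"
  positive :: "'v set \<Rightarrow> bool"
  time1 :: nat
  time2 :: nat
  time_pos :: nat
  capacity :: nat                   \<comment> \<open>number of cells of each array\<close>
  num_bufs :: nat                   \<comment> \<open>number of answer buffers\<close>
  max_word :: nat                   \<comment> \<open>largest number that fits into a machine word\<close>

fun binop_val :: "binop \<Rightarrow> nat \<Rightarrow> nat \<Rightarrow> nat" where
  "binop_val Add a b = a + b"
| "binop_val Sub a b = a - b"
| "binop_val Mul a b = a * b"
| "binop_val Less a b = (if a < b then 1 else 0)"
| "binop_val Equal a b = (if a = b then 1 else 0)"

fun val :: "'v state \<Rightarrow> expr \<Rightarrow> nat" where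
  "val s (Num k) = k"
| "val s (Reg r) = regs s r"
| "val s (Load a e) = arrs s a (val s e)"
| "val s (Bin f e1 e2) = binop_val f (val s e1) (val s e2)"

text \<open>An expression is safe if no intermediate result overflows and no array bound is violated.\<close>

fun safe :: "'v machine \<Rightarrow> 'v state \<Rightarrow> expr \<Rightarrow> bool" where
  "safe M s (Num k) \<longleftrightarrow> k \<le> max_word M"
| "safe M s (Reg r) \<longleftrightarrow> True"
| "safe M s (Load a e) \<longleftrightarrow> safe M s e \<and> val s e < capacity M"
| "safe M s (Bin f e1 e2) \<longleftrightarrow>
     safe M s e1 \<and> safe M s e2 \<and> binop_val f (val s e1) (val s e2) \<le> max_word M"

fun cost :: "expr \<Rightarrow> nat" where
  "cost (Num k) = 1"
| "cost (Reg r) = 1"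
| "cost (Load a e) = 1 + cost e"
| "cost (Bin f e1 e2) = 1 + cost e1 + cost e2"

definition decode :: "'v machine \<Rightarrow> (nat \<Rightarrow> nat) \<Rightarrow> 'v set" where
  "decode M b = elem M ` {i. i < num M \<and> b i \<noteq> 0}"

definition encode :: "'v machine \<Rightarrow> 'v set \<Rightarrow> (nat \<Rightarrow> nat) \<Rightarrow> (nat \<Rightarrow> nat)" where
  "encode M X b = (\<lambda>i. if i < num M then (if elem M i \<in> X then 1 else 0) else b i)"

definition set_reg :: "nat \<Rightarrow> nat \<Rightarrow> 'v state \<Rightarrow> 'v state" where
  "set_reg r k s = s\<lparr>regs := (regs s)(r := k)\<rparr>"

definition set_cell :: "nat \<Rightarrow> nat \<Rightarrow> nat \<Rightarrow> 'v state \<Rightarrow> 'v state" where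
  "set_cell a i k s = s\<lparr>arrs := (arrs s)(a := (arrs s a)(i := k))\<rparr>"

definition set_vec :: "'v machine \<Rightarrow> nat \<Rightarrow> 'v set \<Rightarrow> 'v state \<Rightarrow> 'v state" where
  "set_vec M a X s = s\<lparr>arrs := (arrs s)(a := encode M X (arrs s a))\<rparr>"

definition set_buf :: "nat \<Rightarrow> 'v set list \<Rightarrow> 'v state \<Rightarrow> 'v state" where
  "set_buf b Xs s = s\<lparr>bufs := (bufs s)(b := Xs)\<rparr>"

definition tick :: "nat \<Rightarrow> 'v state \<Rightarrow> 'v state" where
  "tick k s = s\<lparr>clock := clock s + k\<rparr>"

definition emit :: "'v set \<Rightarrow> 'v state \<Rightarrow> 'v state" where
  "emit X s = s\<lparr>outs := outs s @ [(clock s, X)]\<rparr>"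

text \<open>
  \<open>exec M c s s'\<close> holds if \<open>c\<close>, started in \<open>s\<close>, terminates in \<open>s'\<close>. There is no \<open>s'\<close> if the
  program diverges, overflows a word, leaves an array or the range of answer buffers, or calls an
  oracle outside its domain. Handing a set over to or from an oracle, a buffer or the output costs
  \<open>n\<close> steps in addition to the running time of the oracle.
\<close>

inductive exec :: "'v machine \<Rightarrow> com \<Rightarrow> 'v state \<Rightarrow> 'v state \<Rightarrow> bool" for M where
  Skip: "exec M Skip s (tick 1 s)"
| Assign: "safe M s e \<Longrightarrow> exec M (Assign r e) s (tick (1 + cost e) (set_reg r (val s e) s))"
| Store: "safe M s e1 \<Longrightarrow> safe M s e2 \<Longrightarrow> val s e1 < capacity M \<Longrightarrow>
    exec M (Store a e1 e2) s (tick (1 + cost e1 + cost e2) (set_cell a (val s e1) (val s e2) s))"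
| Seq: "exec M c1 s s' \<Longrightarrow> exec M c2 s' s'' \<Longrightarrow> exec M (Seq c1 c2) s s''"
| IfTrue: "safe M s e \<Longrightarrow> val s e \<noteq> 0 \<Longrightarrow> exec M c1 (tick (1 + cost e) s) s' \<Longrightarrow>
    exec M (If e c1 c2) s s'"
| IfFalse: "safe M s e \<Longrightarrow> val s e = 0 \<Longrightarrow> exec M c2 (tick (1 + cost e) s) s' \<Longrightarrow>
    exec M (If e c1 c2) s s'"
| WhileTrue: "safe M s e \<Longrightarrow> val s e \<noteq> 0 \<Longrightarrow> exec M c (tick (1 + cost e) s) s' \<Longrightarrow>
    exec M (While e c) s' s'' \<Longrightarrow> exec M (While e c) s s''"
| WhileFalse: "safe M s e \<Longrightarrow> val s e = 0 \<Longrightarrow> exec M (While e c) s (tick (1 + cost e) s)"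
| CallL1: "X = decode M (arrs s x) \<Longrightarrow> Y = decode M (arrs s y) \<Longrightarrow> X \<noteq> {} \<Longrightarrow> X \<subseteq> Y \<Longrightarrow>
    exec M (CallL1 x y z) s (tick (1 + num M + time1 M) (set_vec M z (oracle1 M X Y) s))"
| CallL2: "Y = decode M (arrs s y) \<Longrightarrow> Y \<noteq> {} \<Longrightarrow> safe M s e \<Longrightarrow> val s e < num_bufs M \<Longrightarrow>
    exec M (CallL2 e y) s
      (tick (1 + cost e + num M + time2 M) (set_buf (val s e) (oracle2 M Y) s))"
| FetchNone: "safe M s e \<Longrightarrow> val s e < num_bufs M \<Longrightarrow> bufs s (val s e) = [] \<Longrightarrow>
    exec M (Fetch r e a) s (tick (1 + cost e) (set_reg r 0 s))"
| FetchSome: "safe M s e \<Longrightarrow> val s e < num_bufs M \<Longrightarrow> bufs s (val s e) = X # Xs \<Longrightarrow>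
    exec M (Fetch r e a) s
      (tick (1 + cost e + num M) (set_reg r 1 (set_buf (val s e) Xs (set_vec M a X s))))"
| TestPositive: "X = decode M (arrs s x) \<Longrightarrow>
    exec M (TestPositive r x) s
      (tick (1 + num M + time_pos M) (set_reg r (if positive M X then 1 else 0) s))"
| Output: "X = decode M (arrs s x) \<Longrightarrow>
    exec M (Output x) s (emit X (tick (1 + num M) s))"

text \<open>
  Initially the registers \<open>0\<close> and \<open>1\<close> hold \<open>n\<close> and \<open>q\<close>, array \<open>0\<close> holds the \<open>n \<times> q\<close> incidence
  matrix of \<open>\<sigma>\<close> row by row, and everything else is blank.
\<close>

definition input_state ::
  "'v machine \<Rightarrow> nat \<Rightarrow> (nat \<Rightarrow> 'i) \<Rightarrow> ('v \<Rightarrow> 'i set) \<Rightarrow> 'v state" where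
  "input_state M q item \<sigma> =
     \<lparr>regs = (\<lambda>_. 0)(0 := num M, 1 := q),
      arrs = (\<lambda>_ _. 0)(0 := (\<lambda>j. if j < num M * q \<and> item (j mod q) \<in> \<sigma> (elem M (j div q))
                                then 1 else 0)),
      bufs = (\<lambda>_. []), clock = 0, outs = []\<rparr>"

definition input_fits :: "'v machine \<Rightarrow> nat \<Rightarrow> bool" where
  "input_fits M q \<longleftrightarrow> num M \<le> max_word M \<and> q \<le> max_word M \<and> num M * q \<le> capacity M"


section \<open>Delay and space\<close>

text \<open>
  For outputs at times \<open>t\<^sub>1, \<dots>, t\<^sub>m\<close> and halting time \<open>T\<close>, this is the maximum of \<open>t\<^sub>1\<close>,
  \<open>t\<^sub>2 - t\<^sub>1\<close>, \<open>\<dots>\<close>, \<open>t\<^sub>m - t\<^sub>m\<^sub>-\<^sub>1\<close> and \<open>T - t\<^sub>m\<close> (just \<open>T\<close> if there is no output).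
\<close>

definition delay :: "nat list \<Rightarrow> nat \<Rightarrow> nat" where
  "delay ts T = Max (set (map2 (-) (ts @ [T]) (0 # ts)))"

definition enumerates_with_delay ::
  "com \<Rightarrow> 'v machine \<Rightarrow> 'v state \<Rightarrow> 'v set set \<Rightarrow> nat \<Rightarrow> bool" where
  "enumerates_with_delay P M s A D \<longleftrightarrow>
     (\<exists>s'. exec M P s s' \<and>
        distinct (map snd (outs s')) \<and> set (map snd (outs s')) = A \<and>
        delay (map fst (outs s')) (clock s') \<le> D)"

fun expr_regs :: "expr \<Rightarrow> nat set" where
  "expr_regs (Num k) = {}"
| "expr_regs (Reg r) = {r}"
| "expr_regs (Load a e) = expr_regs e"
| "expr_regs (Bin f e1 e2) = expr_regs e1 \<union> expr_regs e2"

fun expr_arrs :: "expr \<Rightarrow> nat set" where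
  "expr_arrs (Num k) = {}"
| "expr_arrs (Reg r) = {}"
| "expr_arrs (Load a e) = insert a (expr_arrs e)"
| "expr_arrs (Bin f e1 e2) = expr_arrs e1 \<union> expr_arrs e2"

fun com_regs :: "com \<Rightarrow> nat set" where
  "com_regs Skip = {}"
| "com_regs (Assign r e) = insert r (expr_regs e)"
| "com_regs (Store a e1 e2) = expr_regs e1 \<union> expr_regs e2"
| "com_regs (Seq c1 c2) = com_regs c1 \<union> com_regs c2"
| "com_regs (If e c1 c2) = expr_regs e \<union> com_regs c1 \<union> com_regs c2"
| "com_regs (While e c) = expr_regs e \<union> com_regs c"
| "com_regs (CallL1 x y z) = {}"
| "com_regs (CallL2 e y) = expr_regs e"
| "com_regs (Fetch r e a) = insert r (expr_regs e)"
| "com_regs (TestPositive r x) = {r}"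
| "com_regs (Output x) = {}"

fun com_arrs :: "com \<Rightarrow> nat set" where
  "com_arrs Skip = {}"
| "com_arrs (Assign r e) = expr_arrs e"
| "com_arrs (Store a e1 e2) = insert a (expr_arrs e1 \<union> expr_arrs e2)"
| "com_arrs (Seq c1 c2) = com_arrs c1 \<union> com_arrs c2"
| "com_arrs (If e c1 c2) = expr_arrs e \<union> com_arrs c1 \<union> com_arrs c2"
| "com_arrs (While e c) = expr_arrs e \<union> com_arrs c"
| "com_arrs (CallL1 x y z) = {x, y, z}"
| "com_arrs (CallL2 e y) = insert y (expr_arrs e)"
| "com_arrs (Fetch r e a) = insert a (expr_arrs e)"
| "com_arrs (TestPositive r x) = {x}"
| "com_arrs (Output x) = {x}"

text \<open>
  Space in machine words, with array \<open>0\<close>, the input, always counted. Every answer buffer accounts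
  for the space of one run of the second oracle. The other two oracles keep nothing between calls,
  so each needs its space once.
\<close>

definition space :: "com \<Rightarrow> 'v machine \<Rightarrow> nat \<Rightarrow> nat \<Rightarrow> nat \<Rightarrow> nat" where
  "space P M space1 space2 space_pos =
     card ({0, 1} \<union> com_regs P) + card (insert 0 (com_arrs P)) * capacity M
     + num_bufs M * space2 + space1 + space_pos"

end

(*
  The nonempty positive solutions form a forest. For a solution X outside the maximal components of V,
  scan the items of X in order and keep an item whenever the set of elements carrying all items kept
  so far and this one still contains a component strictly larger than X; one call of the first oracle
  decides this. The parent of X is the component that the oracle then returns above X in the set of
  elements carrying the kept items. It is a solution whose items are exactly the kept ones, it is
  strictly larger than X, and by monotonicity it is positive. If j is the first item that was not
  kept, then X is a maximal component of the part of its parent that carries j. So all children of Y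
  are found by calling the second oracle once for every item that Y lacks and by recomputing first
  rejected item and parent of each candidate; this also rules out repetitions.

  A depth-first traversal outputs sets of odd depth when entering them and sets of even depth when
  leaving them, so that the work between two outputs is that of a constant number of nodes. The sets
  on the current path are nested, hence one number per element stores the whole path.
*)
theory Submission
  imports Defs
begin

section \<open>The forest of solutions\<close>

text \<open>The components need not be closed under any operation, so a solution may lie below many
  maximal components of the same set. The parent therefore builds on the answers of the first
  oracle, modelled as a function and hence repeatable: recomputing a parent gives the same set. The
  scan has a second use: a rejected item certifies that the scanned component is a solution, and
  this is how the program recognises solutions below the roots. A candidate costs at most
  \<open>q + 1\<close> calls of the first oracle, an item one call of the second oracle and up to
  \<open>\<delta> V\<close> candidates, a node \<open>q\<close> items; this product is the delay.
  The obstacle is to turn it into a worst-case bound, since a traversal may climb or descend through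
  many nodes in a row. For this purpose the list of outputs still due is tracked exactly, and a
  potential pays for the work up to the next output.\<close>

locale oracle_instance =
  fixes V :: "'v set" and C :: "'v set set" and I :: "'i set" and \<sigma> :: "'v \<Rightarrow> 'i set"
    and \<rho> :: "'v set \<Rightarrow> real" and \<delta> :: "'v set \<Rightarrow> nat"
    and l1 :: "'v set \<Rightarrow> 'v set \<Rightarrow> 'v set" and l2 :: "'v set \<Rightarrow> 'v set list"
    and n q :: nat and el :: "nat \<Rightarrow> 'v" and item :: "nat \<Rightarrow> 'i"
  assumes inst: "is_instance V C I \<sigma>" and n_def: "n = card V" and q_def: "q = card I"
    and el: "bij_betw el {..<n} V" and item: "bij_betw item {..<q} I"
    and l1: "is_L1 V C l1" and l2: "is_L2 V C l2"
    and vol: "volume_function V \<rho>" and bound: "component_bound V C \<delta>" and \<delta>_pos: "\<delta> V \<ge> 1"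
begin

text \<open>Items enter by their numbers below \<open>q\<close>, since the greedy scan depends on an
  order of the items.\<close>

definition its :: "'v set \<Rightarrow> nat set" where
  "its X = {j. j < q \<and> (\<forall>v\<in>X. item j \<in> \<sigma> v)}"

definition supp :: "nat set \<Rightarrow> 'v set" where
  "supp J = {v \<in> V. \<forall>j\<in>J. item j \<in> \<sigma> v}"

text \<open>Its negation covers two notions at once: maximality of a component inside
  \<open>Y\<close> and, with \<open>Y\<close> the support of its own items, being a
  solution.\<close>

definition improvable :: "'v set \<Rightarrow> 'v set \<Rightarrow> bool" where
  "improvable X Y \<longleftrightarrow> (\<exists>Z\<in>C. X \<subset> Z \<and> Z \<subseteq> Y)"

text \<open>The recursion by stages mirrors the loop of the program, whose invariant refers to
  \<open>kept X k\<close> after \<open>k\<close> items.\<close>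

primrec kept :: "'v set \<Rightarrow> nat \<Rightarrow> nat set" where
  "kept X 0 = {}"
| "kept X (Suc k) =
     (if k \<in> its X \<and> l1 X (supp (insert k (kept X k))) \<noteq> X then insert k (kept X k) else kept X k)"

text \<open>The value \<open>q\<close> stands for: no item rejected so far.\<close>

primrec first_rejected :: "'v set \<Rightarrow> nat \<Rightarrow> nat" where
  "first_rejected X 0 = q"
| "first_rejected X (Suc k) =
     (if k \<in> its X \<and> l1 X (supp (insert k (kept X k))) = X \<and> first_rejected X k = q then k
      else first_rejected X k)"

definition parent :: "'v set \<Rightarrow> 'v set" where
  "parent X = l1 X (supp (kept X q))"

text \<open>The part of being a node that has to be tested directly; a rejected item, or maximality
  in \<open>V\<close>, supplies the solution property.\<close>

definition good :: "'v set \<Rightarrow> bool" where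
  "good X \<longleftrightarrow> X \<noteq> {} \<and> \<rho> X > 0"

definition nodes :: "'v set set" where
  "nodes = {X \<in> solutions C I \<sigma>. \<rho> X > 0 \<and> X \<noteq> {}}"

definition is_kid :: "'v set \<Rightarrow> nat \<Rightarrow> 'v set \<Rightarrow> bool" where
  "is_kid Y j X \<longleftrightarrow> good X \<and> first_rejected X q = j \<and> parent X = Y"

text \<open>The two empty cases keep every candidate strictly below \<open>Y\<close> and the second
  oracle inside its domain of non-empty sets.\<close>

definition candidates :: "'v set \<Rightarrow> nat \<Rightarrow> 'v set list" where
  "candidates Y j = (if j \<in> its Y \<or> Y \<inter> supp {j} = {} then [] else l2 (Y \<inter> supp {j}))"

abbreviation kids :: "'v set \<Rightarrow> nat \<Rightarrow> 'v set list" where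
  "kids Y j \<equiv> filter (is_kid Y j) (candidates Y j)"

section \<open>Solutions and maximal components in terms of improvability\<close>

lemma fin: "finite V" and C_sub: "X \<in> C \<Longrightarrow> X \<subseteq> V" and V_ne: "V \<noteq> {}"
  and I_fin: "finite I" and I_ne: "I \<noteq> {}"
  using inst by (auto simp: is_instance_def set_system_def)

lemma n_pos: "n \<ge> 1" and q_pos: "q \<ge> 1"
  using fin V_ne I_fin I_ne n_def q_def by (simp_all add: Suc_le_eq card_gt_0_iff)

lemma its_anti: "X \<subseteq> Y \<Longrightarrow> its Y \<subseteq> its X" by (auto simp: its_def)
lemma its_lt: "j \<in> its X \<Longrightarrow> j < q" by (auto simp: its_def)
lemma supp_sub: "supp J \<subseteq> V" by (auto simp: supp_def)
lemma supp_anti: "J \<subseteq> K \<Longrightarrow> supp K \<subseteq> supp J" by (auto simp: supp_def)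
lemma sub_supp: "X \<subseteq> V \<Longrightarrow> J \<subseteq> its X \<Longrightarrow> X \<subseteq> supp J" by (auto simp: supp_def its_def)
lemma its_supp: "X \<subseteq> supp J \<Longrightarrow> J \<subseteq> {..<q} \<Longrightarrow> J \<subseteq> its X" by (auto simp: supp_def its_def)

lemma common_items_its: "common_items I \<sigma> X = item ` its X"
proof -
  have "I = item ` {..<q}" using item by (simp add: bij_betw_def)
  then show ?thesis by (auto simp: common_items_def its_def)
qed

lemma common_items_less: "common_items I \<sigma> Y \<subset> common_items I \<sigma> X \<longleftrightarrow> its Y \<subset> its X"
proof -
  have inj: "inj_on item {..<q}" using item by (simp add: bij_betw_def)
  have "item ` A \<subseteq> item ` B \<longleftrightarrow> A \<subseteq> B" if "A \<subseteq> {..<q}" "B \<subseteq> {..<q}" for A B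
    using that inj_on_image_mem_iff[OF inj _ that(2)] by blast
  moreover have "its X \<subseteq> {..<q}" "its Y \<subseteq> {..<q}" by (auto simp: its_def)
  ultimately show ?thesis unfolding common_items_its less_le_not_le by simp
qed

text \<open>Passing to supersets can only remove items, so a larger component violates the solution
  property exactly if it loses none, which means that it lies in
  \<open>supp (its X)\<close>.\<close>

lemma solution_iff: "X \<in> solutions C I \<sigma> \<longleftrightarrow> X \<in> C \<and> \<not> improvable X (supp (its X))"
proof
  assume *: "X \<in> solutions C I \<sigma>"
  have "its Y \<subset> its X" if "Y \<in> C" "X \<subset> Y" for Y
    using * that common_items_less by (auto simp: solutions_def)
  moreover have "its X \<subseteq> its Y" if "Y \<subseteq> supp (its X)" for Y
    using that by (rule its_supp) (auto simp: its_def)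
  ultimately have "\<not> (Y \<in> C \<and> X \<subset> Y \<and> Y \<subseteq> supp (its X))" for Y
    by (meson less_le_not_le)
  then show "X \<in> C \<and> \<not> improvable X (supp (its X))"
    using * by (auto simp: improvable_def solutions_def)
next
  assume *: "X \<in> C \<and> \<not> improvable X (supp (its X))"
  have "its Y \<subset> its X" if "Y \<in> C" "X \<subset> Y" for Y
  proof -
    have "\<not> Y \<subseteq> supp (its X)" using * that by (auto simp: improvable_def)
    then have "\<not> its X \<subseteq> its Y" using sub_supp C_sub that by blast
    then show ?thesis using its_anti[of X Y] that by blast
  qed
  then show "X \<in> solutions C I \<sigma>" using * common_items_less by (auto simp: solutions_def)
qed

lemma max_components_iff: "X \<in> max_components C Y \<longleftrightarrow> X \<in> C \<and> X \<subseteq> Y \<and> \<not> improvable X Y"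
  by (auto simp: max_components_def improvable_def)

lemma improvable_mono: "improvable X Y \<Longrightarrow> Y \<subseteq> Y' \<Longrightarrow> improvable X Y'"
  unfolding improvable_def by (meson order_trans)

text \<open>Lying in \<open>supp J\<close> gives \<open>X\<close> all items of \<open>J\<close>,
  hence \<open>supp (its X)\<close> is contained in \<open>supp J\<close>; a component that cannot
  grow in a set cannot grow in a smaller one.\<close>

lemma max_component_solution:
  assumes "X \<in> max_components C (supp J)" "J \<subseteq> {..<q}"
  shows "X \<in> solutions C I \<sigma>"
  using assms improvable_mono supp_anti[OF its_supp[of X J]]
  by (fastforce simp: max_components_iff solution_iff)

text \<open>\<open>X\<close> itself is a component between \<open>X\<close> and \<open>Y\<close>,
  and by finiteness some maximal one lies above it, so the oracle cannot answer with the empty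
  set.\<close>

lemma l1_component:
  assumes X: "X \<in> C" "X \<noteq> {}" "X \<subseteq> Y" "Y \<subseteq> V"
  shows "l1 X Y \<in> max_components C Y" "X \<subseteq> l1 X Y"
proof -
  let ?F = "{Z \<in> C. X \<subseteq> Z \<and> Z \<subseteq> Y}"
  have "finite ?F" using finite_subset[OF assms(4) fin] by (auto intro: finite_subset[of _ "Pow Y"])
  moreover have "?F \<noteq> {}" using X by auto
  ultimately obtain Z where "Z \<in> ?F" "\<forall>W\<in>?F. Z \<subseteq> W \<longrightarrow> Z = W"
    using finite_has_maximal[of ?F] by auto
  then have "Z \<in> max_components_between C X Y"
    by (auto simp: max_components_between_def max_components_def)
  then have "l1 X Y \<in> max_components_between C X Y"
    using l1 X unfolding is_L1_def by (metis empty_iff)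
  then show "l1 X Y \<in> max_components C Y" "X \<subseteq> l1 X Y"
    by (auto simp: max_components_between_def)
qed

text \<open>A maximal \<open>X\<close> leaves the oracle no other answer, and a non-maximal
  \<open>X\<close> is never a legal one. This is why a single call decides the test of the
  scan.\<close>

lemma l1_fixed_iff:
  assumes "X \<in> C" "X \<noteq> {}" "X \<subseteq> Y" "Y \<subseteq> V"
  shows "l1 X Y = X \<longleftrightarrow> \<not> improvable X Y"
  using l1_component[OF assms] assms(1) by (auto simp: max_components_iff improvable_def)

section \<open>The greedy scan of the items and the parent\<close>

lemma kept_mono: "i \<le> k \<Longrightarrow> kept X i \<subseteq> kept X k"
  by (induction k rule: dec_induct) auto

lemma kept_sub: "kept X k \<subseteq> its X" by (induction k) auto

lemma kept_lt: "kept X k \<subseteq> {..<k}" by (induction k) auto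

lemma kept_Suc_iff: "k \<in> kept X (Suc k) \<longleftrightarrow> k \<in> its X \<and> l1 X (supp (insert k (kept X k))) \<noteq> X"
  using kept_lt[of X k] by auto

lemma kept_stable: "i \<in> kept X k \<Longrightarrow> i \<in> kept X (Suc i)"
proof (induction k)
  case (Suc k)
  then show ?case by (cases "i = k") (auto split: if_splits)
qed simp

text \<open>The fate of item \<open>i\<close> is settled at stage \<open>i\<close> and never
  revised.\<close>

lemma not_kept_iff:
  assumes "i \<in> its X"
  shows "i \<notin> kept X q \<longleftrightarrow> l1 X (supp (insert i (kept X i))) = X"
  using kept_Suc_iff[of i X] kept_mono[of "Suc i" q X] kept_stable[of i X q] assms its_lt[OF assms]
  by auto

text \<open>The bound \<open>k \<le> q\<close> protects the default value: an item rejected before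
  stage \<open>k\<close> has an index below \<open>q\<close>, so it is never mistaken for no
  rejection.\<close>

lemma first_rejected_cases:
  "k \<le> q \<Longrightarrow> (first_rejected X k = q \<and> its X \<inter> {..<k} \<subseteq> kept X k) \<or>
    (first_rejected X k < k \<and> first_rejected X k \<in> its X \<and> first_rejected X k \<notin> kept X k)"
proof (induction k)
  case (Suc k)
  moreover have "k \<notin> kept X k" using kept_lt[of X k] by auto
  ultimately show ?case by (auto simp: less_Suc_eq)
qed simp

lemma first_rejected_le: "k \<le> q \<Longrightarrow> first_rejected X k \<le> q"
  using first_rejected_cases[of k X] by linarith

lemma rejected_not_improvable:
  assumes X: "X \<in> C" "X \<noteq> {}" and i: "i \<in> its X" "i \<notin> kept X q"
  shows "\<not> improvable X (supp (insert i (kept X i)))"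
proof -
  have "X \<subseteq> supp (insert i (kept X i))" using i kept_sub C_sub[OF X(1)] by (intro sub_supp) auto
  then show ?thesis using l1_fixed_iff[OF X] supp_sub i not_kept_iff by auto
qed

text \<open>The rejected item and the items kept before it all belong to \<open>X\<close>, so
  \<open>supp (its X)\<close> lies in the set where the rejection found no larger component.\<close>

lemma rejected_solution:
  assumes X: "X \<in> C" "X \<noteq> {}" and r: "first_rejected X q < q"
  shows "X \<in> solutions C I \<sigma>"
proof -
  let ?r = "first_rejected X q"
  have *: "?r \<in> its X" "?r \<notin> kept X q" using first_rejected_cases[of q X] r by auto
  have "insert ?r (kept X ?r) \<subseteq> its X" using * kept_sub by auto
  then show ?thesis
    using rejected_not_improvable[OF X *] improvable_mono supp_anti X by (auto simp: solution_iff)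
qed

lemma parent_superset:
  assumes X: "X \<in> C" "X \<noteq> {}"
  shows "parent X \<in> max_components C (supp (kept X q))" "X \<subseteq> parent X"
  unfolding parent_def
  by (rule l1_component[OF X sub_supp[OF C_sub[OF X(1)] kept_sub] supp_sub])+

text \<open>Invariant of the scan: an item enters only if a larger component survives in the
  shrunken support.\<close>

lemma kept_improvable:
  assumes X: "X \<in> C" "X \<noteq> {}" and i: "improvable X V"
  shows "improvable X (supp (kept X k))"
proof (induction k)
  case 0 then show ?case using i by (simp add: supp_def)
next
  case (Suc k)
  have "X \<subseteq> supp (insert k (kept X k))" if "k \<in> its X"
    using that kept_sub C_sub[OF X(1)] by (intro sub_supp) auto
  then show ?case using Suc l1_fixed_iff[OF X] supp_sub by auto
qed

lemma parent_props:
  assumes X: "X \<in> C" "X \<noteq> {}" and i: "improvable X V"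
  shows "X \<subset> parent X" "its (parent X) = kept X q" "parent X \<in> solutions C I \<sigma>"
proof -
  note P = parent_superset[OF X]
  show sub: "X \<subset> parent X" using P kept_improvable[OF X i] by (auto simp: max_components_iff)
  have q: "kept X q \<subseteq> {..<q}" by (rule kept_lt)
  have Psupp: "parent X \<subseteq> supp (kept X q)" "parent X \<in> C" using P by (auto simp: max_components_iff)
  have "j \<in> kept X q" if j: "j \<in> its (parent X)" for j
  proof (rule ccontr)
    assume nj: "j \<notin> kept X q"
    have jX: "j \<in> its X" using its_anti[OF P(2)] j by auto
    have "parent X \<subseteq> supp (kept X j)"
      using Psupp supp_anti[OF kept_mono[of j q X]] its_lt[OF j] by auto
    \<comment> \<open>The parent would be a strictly larger component in the very set in which
      \<open>j\<close> was rejected.\<close>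
    then have "parent X \<subseteq> supp (insert j (kept X j))"
      using j unfolding supp_def its_def by blast
    then show False using rejected_not_improvable[OF X jX nj] sub Psupp by (auto simp: improvable_def)
  qed
  then show "its (parent X) = kept X q" using its_supp[OF Psupp(1) q] by auto
  show "parent X \<in> solutions C I \<sigma>" using max_component_solution[OF P(1) q] .
qed

section \<open>Nodes, candidates and completeness of the search for children\<close>

lemma nodes_iff: "X \<in> nodes \<longleftrightarrow> good X \<and> X \<in> solutions C I \<sigma>"
  by (auto simp: nodes_def good_def)

lemma node_C: "X \<in> nodes \<Longrightarrow> X \<in> C" "X \<in> nodes \<Longrightarrow> X \<noteq> {}"
  by (auto simp: nodes_def solutions_def)

lemma good_mono: "good X \<Longrightarrow> X \<subseteq> Y \<Longrightarrow> Y \<subseteq> V \<Longrightarrow> good Y"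
  using vol unfolding good_def volume_function_def by (metis less_le_trans subset_empty)

lemma set_l2: "Y \<noteq> {} \<Longrightarrow> Y \<subseteq> V \<Longrightarrow> set (l2 Y) = max_components C Y"
  and distinct_l2: "Y \<noteq> {} \<Longrightarrow> Y \<subseteq> V \<Longrightarrow> distinct (l2 Y)"
  using l2 by (auto simp: is_L2_def)

lemma length_l2: "Y \<noteq> {} \<Longrightarrow> Y \<subseteq> V \<Longrightarrow> length (l2 Y) \<le> \<delta> V"
  using bound distinct_card[of "l2 Y"] set_l2[of Y] distinct_l2[of Y]
  by (metis component_bound_def order.trans order_refl)

text \<open>Some element of \<open>Y\<close> lacks item \<open>j\<close>, whereas all elements of a
  candidate carry it; this makes the inclusion strict.\<close>

lemma candidates_sub:
  assumes "X \<in> set (candidates Y j)" "Y \<subseteq> V" "j < q"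
  shows "X \<in> C" "X \<subset> Y"
proof -
  have "X \<in> max_components C (Y \<inter> supp {j})" "j \<notin> its Y"
    using assms set_l2[of "Y \<inter> supp {j}"] by (auto simp: candidates_def split: if_splits)
  then show "X \<in> C" "X \<subset> Y" using assms(2,3) by (auto simp: max_components_iff supp_def its_def)
qed

lemma distinct_candidates: "Y \<subseteq> V \<Longrightarrow> distinct (candidates Y j)"
  using distinct_l2[of "Y \<inter> supp {j}"] by (auto simp: candidates_def)

lemma length_candidates: "Y \<subseteq> V \<Longrightarrow> length (candidates Y j) \<le> \<delta> V"
  using length_l2[of "Y \<inter> supp {j}"] by (auto simp: candidates_def)

lemma is_kid_node:
  assumes "X \<in> C" "is_kid Y j X" "j < q"
  shows "X \<in> nodes"
  using assms rejected_solution by (auto simp: is_kid_def nodes_iff good_def)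

lemma kids_props:
  assumes Y: "Y \<in> nodes" and j: "j < q" and X: "X \<in> set (kids Y j)"
  shows "X \<in> nodes" "X \<subset> Y" "parent X = Y" "first_rejected X q = j" "improvable X V"
proof -
  have k: "is_kid Y j X" "X \<in> set (candidates Y j)" using X by auto
  note c = candidates_sub[OF k(2) C_sub[OF node_C(1)[OF Y]] j]
  show "X \<in> nodes" "X \<subset> Y" using is_kid_node[OF c(1) k(1) j] c(2) by auto
  show "parent X = Y" "first_rejected X q = j" using k by (auto simp: is_kid_def)
  show "improvable X V" using c(2) node_C[OF Y] C_sub[of Y] by (auto simp: improvable_def)
qed

lemma parent_node:
  assumes X: "X \<in> nodes" and i: "improvable X V"
  shows "parent X \<in> nodes" "X \<subset> parent X" "first_rejected X q < q"
    "X \<in> set (kids (parent X) (first_rejected X q))"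
proof -
  note p = parent_props[OF node_C[OF X] i]
  let ?P = "parent X" and ?r = "first_rejected X q"
  have PC: "?P \<in> C" "?P \<subseteq> V" using p(3) C_sub by (auto simp: solutions_def)
  have gX: "good X" using X by (simp add: nodes_iff)
  show "?P \<in> nodes" using p gX good_mono[OF gX _ PC(2)] by (auto simp: nodes_iff)
  show sub: "X \<subset> ?P" by (rule p)
  \<comment> \<open>As a solution, \<open>X\<close> has an item that its larger parent lacks. The
    parent has exactly the kept items, so this item was rejected.\<close>
  have "its ?P \<subset> its X"
    using X PC sub common_items_less by (auto simp: nodes_def solutions_def)
  then have r: "?r < q" "?r \<in> its X" "?r \<notin> kept X q"
    using first_rejected_cases[of q X] p(2) by (auto simp: its_def)
  show "?r < q" by (rule r)
  have XS: "X \<subseteq> ?P \<inter> supp {?r}" using sub r node_C[OF X] C_sub[of X] by (auto simp: supp_def its_def)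
  \<comment> \<open>The parent carries all items kept before \<open>?r\<close>, so its part carrying
    \<open>?r\<close> lies in the set of the rejection test for \<open>?r\<close>.\<close>
  have "\<not> improvable X (?P \<inter> supp {?r})"
  proof
    assume "improvable X (?P \<inter> supp {?r})"
    moreover have "?P \<subseteq> supp (kept X ?r)"
      using parent_superset[OF node_C[OF X]] supp_anti[OF kept_mono[of ?r q X]] r
      by (auto simp: max_components_iff)
    then have "?P \<inter> supp {?r} \<subseteq> supp (insert ?r (kept X ?r))" by (auto simp: supp_def)
    ultimately show False
      using improvable_mono rejected_not_improvable[OF node_C[OF X] r(2,3)] by blast
  qed
  then have "X \<in> max_components C (?P \<inter> supp {?r})"
    using XS node_C[OF X] by (auto simp: max_components_iff)
  moreover have "?P \<inter> supp {?r} \<noteq> {}" using XS node_C[OF X] by auto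
  ultimately show "X \<in> set (kids ?P ?r)"
    using r p(2) gX set_l2[of "?P \<inter> supp {?r}"] PC by (auto simp: candidates_def is_kid_def)
qed

text \<open>The Boolean tells whether \<open>Y\<close> has odd depth, in which case it precedes its descendants.\<close>

primrec subtree :: "nat \<Rightarrow> bool \<Rightarrow> 'v set \<Rightarrow> 'v set list" where
  "subtree 0 b Y = []"
| "subtree (Suc k) b Y =
     (if b then [Y] else []) @
     concat (map (\<lambda>j. concat (map (subtree k (\<not> b)) (kids Y j))) [0..<q]) @
     (if b then [] else [Y])"

section \<open>Membership and distinctness of the listings of subtrees\<close>

lemma subtree_Suc_iff:
  "Z \<in> set (subtree (Suc k) b Y) \<longleftrightarrow>
     Z = Y \<or> (\<exists>j<q. \<exists>X\<in>set (kids Y j). Z \<in> set (subtree k (\<not> b) X))"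
  by auto

declare subtree.simps(2)[simp del]

lemma node_finite: "X \<in> nodes \<Longrightarrow> finite X"
  using finite_subset[OF C_sub fin] node_C(1) by blast

lemma node_card: "X \<in> nodes \<Longrightarrow> 1 \<le> card X" "X \<in> nodes \<Longrightarrow> card X \<le> n"
  using node_C(2) node_finite card_mono[OF fin C_sub[OF node_C(1)]] n_def
  by (auto simp: Suc_le_eq card_gt_0_iff)

text \<open>Cardinality pays for the fuel \<open>k\<close> of \<open>subtree\<close>: children are
  strictly smaller, so fuel \<open>card Y\<close> suffices for \<open>Y\<close>.\<close>

lemma kid_card:
  assumes "Y \<in> nodes" "X \<subset> Y"
  shows "card X < card Y" "card Y \<le> Suc k \<Longrightarrow> card X \<le> k"
  using psubset_card_mono[OF node_finite[OF assms(1)] assms(2)] by auto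

lemma subtree_nodes:
  "Y \<in> nodes \<Longrightarrow> Z \<in> set (subtree k b Y) \<Longrightarrow> Z \<in> nodes \<and> Z \<subseteq> Y"
proof (induction k arbitrary: b Y)
  case (Suc k)
  consider "Z = Y" | j X where "j < q" "X \<in> set (kids Y j)" "Z \<in> set (subtree k (\<not> b) X)"
    using Suc.prems(2) unfolding subtree_Suc_iff by blast
  then show ?case
  proof cases
    case 2
    then show ?thesis using Suc.IH[OF _ 2(3)] kids_props(1,2)[OF Suc.prems(1) 2(1,2)] by auto
  qed (use Suc.prems in simp)
qed simp

lemma root_subtree: "Y \<in> nodes \<Longrightarrow> card Y \<le> k \<Longrightarrow> Y \<in> set (subtree k b Y)"
  using node_card(1)[of Y] by (cases k) (auto simp: subtree_Suc_iff)

lemma subtree_closed: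
  assumes "X \<in> nodes" "improvable X V"
  shows "Y \<in> nodes \<Longrightarrow> card Y \<le> k \<Longrightarrow> parent X \<in> set (subtree k b Y) \<Longrightarrow> X \<in> set (subtree k b Y)"
proof (induction k arbitrary: b Y)
  case (Suc k)
  consider "parent X = Y" | j Z where "j < q" "Z \<in> set (kids Y j)" "parent X \<in> set (subtree k (\<not> b) Z)"
    using Suc.prems(3) unfolding subtree_Suc_iff by blast
  then show ?case
  proof cases
    case 1
    note p = parent_node[OF assms]
    have "card X \<le> k" using kid_card(2)[OF parent_node(1,2)[OF assms]] 1 Suc.prems(2) by simp
    then have "X \<in> set (subtree k (\<not> b) X)" by (rule root_subtree[OF assms(1)])
    then show ?thesis using p(3,4) 1 unfolding subtree_Suc_iff by metis
  next
    case 2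
    note p = kids_props[OF Suc.prems(1) 2(1,2)]
    have "card Z \<le> k" using kid_card(2)[OF Suc.prems(1) p(2) Suc.prems(2)] .
    then have "X \<in> set (subtree k (\<not> b) Z)" using Suc.IH[OF p(1) _ 2(3)] by simp
    then show ?thesis using 2(1,2) unfolding subtree_Suc_iff by metis
  qed
qed simp

text \<open>The upward direction drives the proofs of disjointness: two listings with a common
  member share further members up to a root.\<close>

lemma subtree_step:
  "Y \<in> nodes \<Longrightarrow> card Y \<le> k \<Longrightarrow> Z \<in> set (subtree k b Y) \<Longrightarrow>
    Z = Y \<or> improvable Z V \<and> parent Z \<in> set (subtree k b Y)"
proof (induction k arbitrary: b Y)
  case (Suc k)
  consider "Z = Y" | j X where "j < q" "X \<in> set (kids Y j)" "Z \<in> set (subtree k (\<not> b) X)"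
    using Suc.prems(3) unfolding subtree_Suc_iff by blast
  then show ?case
  proof cases
    case 2
    note p = kids_props[OF Suc.prems(1) 2(1,2)]
    have "card X \<le> k" using kid_card(2)[OF Suc.prems(1) p(2) Suc.prems(2)] .
    then have "Z = X \<or> improvable Z V \<and> parent Z \<in> set (subtree k (\<not> b) X)"
      using Suc.IH[OF p(1) _ 2(3)] by simp
    then show ?thesis using p(3,5) 2(1,2) unfolding subtree_Suc_iff by metis
  qed simp
qed simp

lemma subtree_disjoint:
  assumes X: "X \<in> nodes" "card X \<le> k" and X': "X' \<in> nodes" "card X' \<le> k'" and ne: "X \<noteq> X'"
    and out: "X \<notin> set (subtree k' b' X')" "X' \<notin> set (subtree k b X)"
  shows "set (subtree k b X) \<inter> set (subtree k' b' X') = {}"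
proof -
  have "Z \<notin> set (subtree k b X) \<or> Z \<notin> set (subtree k' b' X')" for Z
  \<comment> \<open>A common member is followed upwards: parents are strictly larger and stay in
    both listings until a root is met, which \<open>out\<close> excludes.\<close>
  proof (induction "n - card Z" arbitrary: Z rule: less_induct)
    case less
    show ?case
    proof (rule ccontr)
      assume "\<not> ?thesis"
      then have Z: "Z \<in> set (subtree k b X)" "Z \<in> set (subtree k' b' X')" by auto
      have "Z \<noteq> X" "Z \<noteq> X'" using Z out by auto
      then have *: "improvable Z V" "parent Z \<in> set (subtree k b X)" "parent Z \<in> set (subtree k' b' X')"
        using subtree_step[OF X Z(1)] subtree_step[OF X' Z(2)] by auto
      have Zn: "Z \<in> nodes" using subtree_nodes[OF X(1) Z(1)] by simp
      have "card Z < card (parent Z)" "card (parent Z) \<le> n"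
        using parent_node[OF Zn *(1)] kid_card node_card by auto
      then have "n - card (parent Z) < n - card Z" by linarith
      then show False using less[of "parent Z"] * by auto
    qed
  qed
  then show ?thesis by blast
qed

lemma kids_disjoint:
  assumes Y: "Y \<in> nodes" "card Y \<le> Suc k" and j: "j < q" "j' < q"
    and X: "X \<in> set (kids Y j)" and X': "X' \<in> set (kids Y j')" and ne: "X \<noteq> X'"
  shows "set (subtree k b X) \<inter> set (subtree k b X') = {}"
proof -
  \<comment> \<open>A child listed under a different sibling would bring its parent \<open>Y\<close>
    into that listing, which contains only subsets of the sibling.\<close>
  have *: "X \<notin> set (subtree k b X')"
    if "j < q" "j' < q" "X \<in> set (kids Y j)" "X' \<in> set (kids Y j')" "X \<noteq> X'" for X X' j j'
  proof
    assume a: "X \<in> set (subtree k b X')"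
    note p = kids_props[OF Y(1) that(1,3)] and p' = kids_props[OF Y(1) that(2,4)]
    have "card X' \<le> k" using kid_card(2)[OF Y(1) p'(2) Y(2)] .
    then have "Y \<in> set (subtree k b X')" using subtree_step[OF p'(1) _ a] that(5) p(3) by auto
    then show False using subtree_nodes[OF p'(1)] p'(2) by auto
  qed
  note p = kids_props[OF Y(1) j(1) X] and p' = kids_props[OF Y(1) j(2) X']
  have "card X \<le> k" "card X' \<le> k" using kid_card(2)[OF Y(1) p(2) Y(2)] kid_card(2)[OF Y(1) p'(2) Y(2)] .
  then show ?thesis
    using subtree_disjoint[OF p(1) _ p'(1)] ne *[OF j X X'] *[OF j(2,1) X' X] by auto
qed

lemma distinct_concat_map:
  assumes "distinct xs" "\<And>x. x \<in> set xs \<Longrightarrow> distinct (f x)"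
    "\<And>x y. x \<in> set xs \<Longrightarrow> y \<in> set xs \<Longrightarrow> x \<noteq> y \<Longrightarrow> set (f x) \<inter> set (f y) = {}"
  shows "distinct (concat (map f xs))"
  using assms by (induction xs) auto

lemma distinct_subtree: "Y \<in> nodes \<Longrightarrow> card Y \<le> k \<Longrightarrow> distinct (subtree k b Y)"
proof (induction k arbitrary: b Y)
  case (Suc k)
  have small: "card X \<le> k" "X \<in> nodes" "Y \<notin> set (subtree k b' X)"
    if "j < q" "X \<in> set (kids Y j)" for j X b'
  proof -
    note p = kids_props(1,2)[OF Suc.prems(1) that]
    show "card X \<le> k" using kid_card(2)[OF Suc.prems(1) p(2) Suc.prems(2)] .
    show "X \<in> nodes" by (rule p)
    show "Y \<notin> set (subtree k b' X)" using subtree_nodes[OF p(1)] p(2) by blast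
  qed
  have YV: "Y \<subseteq> V" using node_C[OF Suc.prems(1)] C_sub by auto
  have 1: "distinct (concat (map (subtree k (\<not> b)) (kids Y j)))" if "j < q" for j
    using that small Suc.IH kids_disjoint[OF Suc.prems that that] distinct_candidates[OF YV]
    by (intro distinct_concat_map distinct_filter) auto
  have 2: "set (concat (map (subtree k (\<not> b)) (kids Y j))) \<inter>
      set (concat (map (subtree k (\<not> b)) (kids Y j'))) = {}" if j: "j < q" "j' < q" "j \<noteq> j'" for j j'
  proof -
    \<comment> \<open>\<open>first_rejected\<close> is a function, so the same child cannot turn up
      for two items.\<close>
    have "set (subtree k (\<not> b) X) \<inter> set (subtree k (\<not> b) X') = {}"
      if "X \<in> set (kids Y j)" "X' \<in> set (kids Y j')" for X X'
      using kids_disjoint[OF Suc.prems j(1,2) that] j(3) that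
        kids_props(4)[OF Suc.prems(1) j(1) that(1)] kids_props(4)[OF Suc.prems(1) j(2) that(2)]
      by blast
    then show ?thesis by fastforce
  qed
  have "distinct (concat (map (\<lambda>j. concat (map (subtree k (\<not> b)) (kids Y j))) [0..<q]))"
    by (rule distinct_concat_map[OF distinct_upt 1 2]) simp_all
  then show ?case using small(3) by (auto simp: subtree.simps(2))
qed simp

definition traversal :: "'v set list" where
  "traversal = concat (map (subtree n True) (filter good (l2 V)))"

lemma root_node: "X \<in> set (filter good (l2 V)) \<longleftrightarrow> X \<in> nodes \<and> \<not> improvable X V"
proof -
  \<comment> \<open>A maximal component of \<open>V\<close> is one of
    \<open>supp {}\<close>.\<close>
  have "X \<in> solutions C I \<sigma>" if "X \<in> max_components C V"
    using max_component_solution[of X "{}"] that by (simp add: supp_def)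
  then show ?thesis
    using set_l2[OF V_ne] C_sub by (auto simp: nodes_iff max_components_iff solution_iff)
qed

lemma set_traversal: "set traversal = nodes"
proof -
  have "X \<in> nodes \<Longrightarrow> X \<in> set traversal" for X
  proof (induction "n - card X" arbitrary: X rule: less_induct)
    case less
    show ?case
    proof (cases "improvable X V")
      case False
      then show ?thesis
        using less.prems root_node[of X] root_subtree node_card unfolding traversal_def by fastforce
    next
      case True
      note p = parent_node[OF less.prems True]
      have "card X < card (parent X)" "card (parent X) \<le> n" using p kid_card node_card by auto
      then have "parent X \<in> set traversal" using less p by auto
      then obtain R where "R \<in> set (filter good (l2 V))" "parent X \<in> set (subtree n True R)"
        unfolding traversal_def by auto
      then show ?thesis
        using subtree_closed[OF less.prems True, of R n True] root_node[of R] node_card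
        unfolding traversal_def by fastforce
    qed
  qed
  moreover have "set traversal \<subseteq> nodes"
    using root_node subtree_nodes unfolding traversal_def by fastforce
  ultimately show ?thesis by blast
qed

lemma distinct_traversal: "distinct traversal"
proof -
  \<comment> \<open>Roots are not improvable in \<open>V\<close>, whereas every other member of a
    listing is.\<close>
  have out: "X \<notin> set (subtree n True X')"
    if "X \<in> set (filter good (l2 V))" "X' \<in> set (filter good (l2 V))" "X \<noteq> X'" for X X'
    using subtree_step[of X' n X True] root_node that node_card by blast
  show ?thesis unfolding traversal_def
  proof (rule distinct_concat_map)
    show "distinct (filter good (l2 V))" using distinct_l2[OF V_ne] by simp
  next
    fix X assume "X \<in> set (filter good (l2 V))"
    then show "distinct (subtree n True X)" using root_node node_card distinct_subtree by blast
  next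
    fix X X' assume "X \<in> set (filter good (l2 V))" "X' \<in> set (filter good (l2 V))" "X \<noteq> X'"
    then show "set (subtree n True X) \<inter> set (subtree n True X') = {}"
      using out[of X X'] out[of X' X] root_node node_card
      by (intro subtree_disjoint) blast+
  qed
qed

end

section \<open>Weakest preconditions\<close>

text \<open>Total correctness: a terminating run must exist, so safety, oracle domains and
  termination become proof obligations. Time bounds are ordinary postconditions, as the clock
  belongs to the state.\<close>

definition wp :: "'v machine \<Rightarrow> com \<Rightarrow> ('v state \<Rightarrow> bool) \<Rightarrow> 'v state \<Rightarrow> bool" where
  "wp M c Q s \<longleftrightarrow> (\<exists>s'. exec M c s s' \<and> Q s')"

lemma wp_mono: "wp M c Q s \<Longrightarrow> (\<And>s'. Q s' \<Longrightarrow> Q' s') \<Longrightarrow> wp M c Q' s"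
  by (auto simp: wp_def)

lemma wp_state: "wp M c Q s \<Longrightarrow> s = s' \<Longrightarrow> wp M c Q s'"
  by simp

lemma wp_Seq: "wp M c1 (wp M c2 Q) s \<Longrightarrow> wp M (Seq c1 c2) Q s"
  by (auto simp: wp_def intro: exec.Seq)

lemma wp_Skip: "Q (tick 1 s) \<Longrightarrow> wp M Skip Q s"
  by (auto simp: wp_def intro: exec.Skip)

lemma wp_Assign:
  "safe M s e \<Longrightarrow> Q (tick (1 + cost e) (set_reg r (val s e) s)) \<Longrightarrow> wp M (Assign r e) Q s"
  by (auto simp: wp_def intro: exec.Assign)

lemma wp_Store:
  "safe M s e1 \<Longrightarrow> safe M s e2 \<Longrightarrow> val s e1 < capacity M \<Longrightarrow>
    Q (tick (1 + cost e1 + cost e2) (set_cell a (val s e1) (val s e2) s)) \<Longrightarrow>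
    wp M (Store a e1 e2) Q s"
  unfolding wp_def by (blast intro: exec.Store)

lemma wp_If:
  "safe M s e \<Longrightarrow> (val s e \<noteq> 0 \<Longrightarrow> wp M c1 Q (tick (1 + cost e) s)) \<Longrightarrow>
    (val s e = 0 \<Longrightarrow> wp M c2 Q (tick (1 + cost e) s)) \<Longrightarrow> wp M (If e c1 c2) Q s"
  unfolding wp_def by (cases "val s e = 0") (blast intro: exec.IfTrue exec.IfFalse)+

lemma wp_CallL1:
  "decode M (arrs s x) \<noteq> {} \<Longrightarrow> decode M (arrs s x) \<subseteq> decode M (arrs s y) \<Longrightarrow>
    Q (tick (1 + num M + time1 M)
      (set_vec M z (oracle1 M (decode M (arrs s x)) (decode M (arrs s y))) s)) \<Longrightarrow>
    wp M (CallL1 x y z) Q s"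
  unfolding wp_def by (blast intro: exec.CallL1)

lemma wp_CallL2:
  "decode M (arrs s y) \<noteq> {} \<Longrightarrow> safe M s e \<Longrightarrow> val s e < num_bufs M \<Longrightarrow>
    Q (tick (1 + cost e + num M + time2 M)
      (set_buf (val s e) (oracle2 M (decode M (arrs s y))) s)) \<Longrightarrow>
    wp M (CallL2 e y) Q s"
  unfolding wp_def by (blast intro: exec.CallL2)

lemma wp_Fetch:
  "safe M s e \<Longrightarrow> val s e < num_bufs M \<Longrightarrow>
    (bufs s (val s e) = [] \<Longrightarrow> Q (tick (1 + cost e) (set_reg r 0 s))) \<Longrightarrow>
    (\<And>X Xs. bufs s (val s e) = X # Xs \<Longrightarrow>
      Q (tick (1 + cost e + num M) (set_reg r 1 (set_buf (val s e) Xs (set_vec M a X s))))) \<Longrightarrow>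
    wp M (Fetch r e a) Q s"
  unfolding wp_def by (cases "bufs s (val s e)") (blast intro: exec.FetchNone exec.FetchSome)+

lemma wp_TestPositive:
  "Q (tick (1 + num M + time_pos M)
      (set_reg r (if positive M (decode M (arrs s x)) then 1 else 0) s)) \<Longrightarrow>
    wp M (TestPositive r x) Q s"
  unfolding wp_def by (blast intro: exec.TestPositive)

lemma wp_Output:
  "Q (emit (decode M (arrs s x)) (tick (1 + num M) s)) \<Longrightarrow> wp M (Output x) Q s"
  unfolding wp_def by (blast intro: exec.Output)

lemma wp_WhileFalse: "safe M s e \<Longrightarrow> val s e = 0 \<Longrightarrow> Q (tick (1 + cost e) s) \<Longrightarrow> wp M (While e c) Q s"
  unfolding wp_def by (blast intro: exec.WhileFalse)

lemma wp_WhileTrue: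
  "safe M s e \<Longrightarrow> val s e \<noteq> 0 \<Longrightarrow> wp M c (wp M (While e c) Q) (tick (1 + cost e) s) \<Longrightarrow>
    wp M (While e c) Q s"
  unfolding wp_def by (blast intro: exec.WhileTrue)

text \<open>For passes over elements or items, where the number \<open>m\<close> of rounds is fixed
  in advance; the invariant carries the round number and with it the time.\<close>

lemma wp_While_count:
  assumes "J 0 s"
    and step: "\<And>k s. k < m \<Longrightarrow> J k s \<Longrightarrow> safe M s e \<and> val s e \<noteq> 0 \<and> wp M c (J (Suc k)) (tick (1 + cost e) s)"
    and stop: "\<And>s. J m s \<Longrightarrow> safe M s e \<and> val s e = 0 \<and> Q (tick (1 + cost e) s)"
  shows "wp M (While e c) Q s"
proof -
  have "J k s \<Longrightarrow> wp M (While e c) Q s" if "k \<le> m" for k s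
    using that
  proof (induction k arbitrary: s rule: inc_induct)
    case base
    then show ?case using stop by (blast intro: wp_WhileFalse)
  next
    case (step k)
    then show ?case
      using assms(2)[of k s] wp_mono[of M c "J (Suc k)"] by (blast intro: wp_WhileTrue)
  qed
  from this[of 0] show ?thesis using assms(1) by simp
qed

text \<open>For the main loop, whose number of rounds depends on the answers of the oracles.\<close>

lemma wp_While_wf:
  assumes "wf R" "J s"
    and step: "\<And>s. J s \<Longrightarrow> safe M s e \<and>
      (val s e \<noteq> 0 \<longrightarrow> wp M c (\<lambda>s'. J s' \<and> (s', s) \<in> R) (tick (1 + cost e) s)) \<and>
      (val s e = 0 \<longrightarrow> Q (tick (1 + cost e) s))"
  shows "wp M (While e c) Q s"
  using assms(1,2)
proof (induction s rule: wf_induct_rule)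
  case (less s)
  show ?case
  proof (cases "val s e = 0")
    case True
    then show ?thesis using step[OF less.prems] by (blast intro: wp_WhileFalse)
  next
    case False
    then have "wp M c (wp M (While e c) Q) (tick (1 + cost e) s)"
      using step[OF less.prems] less.IH by (auto elim!: wp_mono)
    then show ?thesis using False step[OF less.prems] by (blast intro: wp_WhileTrue)
  qed
qed

section \<open>The program\<close>

abbreviation (input) "rNum \<equiv> 0 :: nat"
abbreviation (input) "rItems \<equiv> 1 :: nat"
abbreviation (input) "rDepth \<equiv> 2 :: nat"
abbreviation (input) "rParity \<equiv> 3 :: nat"
abbreviation (input) "rRun \<equiv> 4 :: nat"
abbreviation (input) "rIndex \<equiv> 5 :: nat"
abbreviation (input) "rFlag \<equiv> 6 :: nat"
abbreviation (input) "rFetched \<equiv> 7 :: nat"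
abbreviation (input) "rPositive \<equiv> 8 :: nat"
abbreviation (input) "rRejected \<equiv> 9 :: nat"
abbreviation (input) "rItem \<equiv> 10 :: nat"
abbreviation (input) "rAccept \<equiv> 11 :: nat"

abbreviation (input) "aIncidence \<equiv> 0 :: nat"
abbreviation (input) "aCandidate \<equiv> 1 :: nat"
abbreviation (input) "aSupport \<equiv> 2 :: nat"
abbreviation (input) "aRestricted \<equiv> 3 :: nat"
abbreviation (input) "aMaximal \<equiv> 4 :: nat"
abbreviation (input) "aLevel \<equiv> 5 :: nat"
abbreviation (input) "aNext \<equiv> 6 :: nat"
abbreviation (input) "aScratch \<equiv> 7 :: nat"

text \<open>Negation on the truth values 0 and 1, by truncated subtraction.\<close>

abbreviation "neg e \<equiv> Bin Sub (Num 1) e"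
abbreviation "cell a \<equiv> Load a (Reg rIndex)"

text \<open>One pass does two jobs: \<open>rFlag\<close> records whether \<open>ec\<close> holds at
  some index, and \<open>ev\<close> overwrites array \<open>a\<close>. A use that needs only the
  array passes \<open>Num 0\<close> as condition; one that needs only the flag writes to
  \<open>aScratch\<close>.\<close>

definition scan :: "nat \<Rightarrow> expr \<Rightarrow> expr \<Rightarrow> com" where
  "scan a ec ev =
     Seq (Assign rFlag (Num 0)) (Seq (Assign rIndex (Num 0))
       (While (Bin Less (Reg rIndex) (Reg rNum))
         (Seq (If ec (Assign rFlag (Num 1)) Skip)
           (Seq (Store a (Reg rIndex) ev)
             (Assign rIndex (Bin Add (Reg rIndex) (Num 1)))))))"

definition scanned :: "nat \<Rightarrow> nat \<Rightarrow> (nat \<Rightarrow> nat) \<Rightarrow> (nat \<Rightarrow> nat) \<Rightarrow> 'v state \<Rightarrow> nat \<Rightarrow> 'v state" where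
  "scanned m a f g s t =
     s\<lparr>regs := (regs s)(rIndex := m, rFlag := (if \<exists>i<m. f i \<noteq> 0 then 1 else 0)),
       arrs := (arrs s)(a := (\<lambda>i. if i < m then g i else arrs s a i)), clock := t\<rparr>"

lemmas state_defs = tick_def set_reg_def set_cell_def set_vec_def set_buf_def emit_def

text \<open>The expressions are considered only in states where cell \<open>i\<close> of the target
  is still old, so they may read the array being overwritten. A round costs at most 13 besides the
  two expressions, and the dearest pair in the program costs 28; hence 30 and 50.\<close>

lemma wp_scan:
  fixes s :: "'v state"
  assumes n: "regs s rNum = m" "m \<le> capacity M" "m < max_word M"
    and small: "cost ec + cost ev \<le> 30"
    and ev: "\<And>i x b t. i < m \<Longrightarrow> b i = arrs s a i \<Longrightarrow>
      safe M (s\<lparr>regs := (regs s)(rIndex := i, rFlag := x), arrs := (arrs s)(a := b), clock := t\<rparr>) ec \<and>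
      val (s\<lparr>regs := (regs s)(rIndex := i, rFlag := x), arrs := (arrs s)(a := b), clock := t\<rparr>) ec = f i \<and>
      safe M (s\<lparr>regs := (regs s)(rIndex := i, rFlag := x), arrs := (arrs s)(a := b), clock := t\<rparr>) ev \<and>
      val (s\<lparr>regs := (regs s)(rIndex := i, rFlag := x), arrs := (arrs s)(a := b), clock := t\<rparr>) ev = g i"
    and Q: "\<And>t. clock s \<le> t \<Longrightarrow> t \<le> clock s + 50 * (m + 1) \<Longrightarrow> Q (scanned m a f g s t)"
  shows "wp M (scan a ec ev) Q s"
proof -
  define J where "J k s' \<longleftrightarrow> (\<exists>t. s' = s\<lparr>regs := (regs s)(rIndex := k, rFlag := (if \<exists>i<k. f i \<noteq> 0 then 1 else 0)),
      arrs := (arrs s)(a := (\<lambda>i. if i < k then g i else arrs s a i)), clock := t\<rparr>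
      \<and> clock s \<le> t \<and> t \<le> clock s + 50 * k + 6)" for k s'
  show ?thesis unfolding scan_def
  proof (intro wp_Seq wp_Assign wp_While_count[where J = J and m = m], goal_cases)
    case 3
    then show ?case using n
      by (auto simp: J_def state_defs intro!: exI[of _ "clock s + 4"] state.equality)
  next
    case (4 k s')
    then obtain t where s': "s' = s\<lparr>regs := (regs s)(rIndex := k, rFlag := (if \<exists>i<k. f i \<noteq> 0 then 1 else 0)),
      arrs := (arrs s)(a := (\<lambda>i. if i < k then g i else arrs s a i)), clock := t\<rparr>"
      and t: "clock s \<le> t" "t \<le> clock s + 50 * k + 6" unfolding J_def by blast
    have *: "wp M (Store a (Reg rIndex) ev) (wp M (Assign rIndex (Bin Add (Reg rIndex) (Num 1))) (J (Suc k)))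
       (s\<lparr>regs := (regs s)(rIndex := k, rFlag := (if \<exists>i<Suc k. f i \<noteq> 0 then 1 else 0)),
      arrs := (arrs s)(a := (\<lambda>i. if i < k then g i else arrs s a i)), clock := t'\<rparr>)"
      if t': "clock s \<le> t'" "t' \<le> clock s + 50 * k + 14 + cost ec" for t'
      using n 4 t' small
      by (intro wp_Store wp_Assign)
        (auto simp: ev state_defs J_def less_Suc_eq fun_eq_iff intro!: exI[of _ "6 + cost ev + t'"])
    show ?case
    proof (intro conjI wp_Seq wp_If wp_Assign wp_Skip, goal_cases)
      case 5
      then have "f k \<noteq> 0" using \<open>k < m\<close> by (simp add: s' state_defs ev)
      then have "(\<exists>i<Suc k. f i \<noteq> 0)" by blast
      then show ?case using t
        by (intro wp_state[OF *[of "t + 7 + cost ec"]]) (auto simp: s' state_defs intro!: state.equality)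
    next
      case 6
      then have "f k = 0" using \<open>k < m\<close> by (simp add: s' state_defs ev)
      then have "(\<exists>i<Suc k. f i \<noteq> 0) = (\<exists>i<k. f i \<noteq> 0)" by (auto simp: less_Suc_eq)
      then show ?case using t
        by (intro wp_state[OF *[of "t + 6 + cost ec"]]) (auto simp: s' state_defs intro!: state.equality)
    qed (use n \<open>k < m\<close> ev in \<open>auto simp: s' state_defs\<close>)
  next
    case (5 s')
    then show ?case using n Q by (auto simp: J_def state_defs scanned_def)
  qed (use n in auto)
qed

abbreviation "present k \<equiv> Load aIncidence (Bin Add (Bin Mul (Reg rIndex) (Reg rItems)) k)"
text \<open>Non-zero exactly on the set on top of the path: elements whose mark reaches the current
  depth.\<close>

abbreviation "at_level \<equiv> neg (Bin Less (cell aLevel) (Reg rDepth))"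
abbreviation "next_index \<equiv> Load aNext (Reg rDepth)"

text \<open>The first pass both restricts the support to the item and flags an element of the
  candidate lacking it. If the flag is set, the item is not common and a call of the first oracle
  would leave its domain.\<close>

definition greedy_step :: com where
  "greedy_step =
     Seq (scan aRestricted (Bin Mul (cell aCandidate) (neg (present (Reg rItem))))
           (Bin Mul (cell aSupport) (present (Reg rItem))))
       (Seq (If (Reg rFlag) Skip
              (Seq (CallL1 aCandidate aRestricted aMaximal)
                (Seq (scan aScratch (neg (Bin Equal (cell aMaximal) (cell aCandidate))) (Num 0))
                  (If (Reg rFlag) (scan aSupport (Num 0) (cell aRestricted))
                    (If (Bin Equal (Reg rRejected) (Reg rItems)) (Assign rRejected (Reg rItem)) Skip)))))
         (Assign rItem (Bin Add (Reg rItem) (Num 1))))"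

definition greedy :: com where
  "greedy =
     Seq (scan aSupport (Num 0) (Num 1))
       (Seq (Assign rRejected (Reg rItems))
         (Seq (Assign rItem (Num 0))
           (Seq (While (Bin Less (Reg rItem) (Reg rItems)) greedy_step)
             (CallL1 aCandidate aSupport aMaximal))))"

text \<open>At depth 0 candidates are roots, without a parent to compare. Elsewhere
  \<open>aNext\<close> has already moved past the item that produced the candidate, whence the added
  1; a bit of the parent equal to the complementary bit of the set on top reveals a
  difference.\<close>

definition check :: com where
  "check =
     If (Reg rDepth)
       (Seq greedy
         (Seq (scan aScratch (Bin Equal (cell aMaximal) (Bin Less (cell aLevel) (Reg rDepth))) (Num 0))
           (Assign rAccept
             (Bin Mul (Bin Equal (Bin Add (Reg rRejected) (Num 1)) next_index) (neg (Reg rFlag))))))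
       (Assign rAccept (Num 1))"

text \<open>Array \<open>aLevel\<close> stores for every element the depth of the last set on the current path that
  contains it; this encodes the path, since its sets are nested. For truncated subtraction,
  \<open>a - (a - d)\<close> is the minimum of \<open>a\<close> and \<open>d\<close>.\<close>

definition push :: com where
  "push =
     Seq (scan aLevel (Num 0)
           (Bin Add (Bin Sub (cell aLevel) (Bin Sub (cell aLevel) (Reg rDepth))) (cell aCandidate)))
       (Seq (Assign rDepth (Bin Add (Reg rDepth) (Num 1)))
         (Seq (Assign rParity (neg (Reg rParity)))
           (Seq (Store aNext (Reg rDepth) (Num 0))
             (If (Reg rParity) (Output aCandidate) Skip))))"

definition try_candidate :: com where
  "try_candidate =
     Seq (scan aScratch (cell aCandidate) (Num 0))
       (If (Reg rFlag)
         (Seq (TestPositive rPositive aCandidate)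
           (If (Reg rPositive) (Seq check (If (Reg rAccept) push Skip)) Skip))
         Skip)"

text \<open>The two passes detect the two cases in which \<open>candidates\<close> is empty: no
  element of the set on top carries the item, or all do.\<close>

definition next_item :: com where
  "next_item =
     Seq (scan aRestricted (Bin Mul at_level (present next_index)) (Bin Mul at_level (present next_index)))
       (Seq (If (Reg rFlag)
              (Seq (scan aScratch (Bin Mul at_level (neg (present next_index))) (Num 0))
                (If (Reg rFlag) (CallL2 (Reg rDepth) aRestricted) Skip))
              Skip)
         (Store aNext (Reg rDepth) (Bin Add next_index (Num 1))))"

definition pop :: com where
  "pop =
     If (Reg rDepth)
       (Seq (If (Reg rParity) Skip (Seq (scan aScratch (Num 0) at_level) (Output aScratch)))
         (Seq (Assign rDepth (Bin Sub (Reg rDepth) (Num 1)))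
           (Assign rParity (neg (Reg rParity)))))
       (Assign rRun (Num 0))"

text \<open>The recursion is unfolded into a loop: a round consumes one candidate, one item or one
  level. The stack consists of the marks, \<open>aNext\<close> and the answer buffers.\<close>

definition step :: com where
  "step =
     Seq (Fetch rFetched (Reg rDepth) aCandidate)
       (If (Reg rFetched) try_candidate
         (If (Bin Less next_index (Reg rItems)) next_item pop))"

text \<open>Depth 0 is a virtual level for \<open>V\<close>. Its item pointer starts at
  \<open>q\<close>, so that only the maximal components of \<open>V\<close> serve as its
  candidates.\<close>

definition enumeration :: com where
  "enumeration =
     Seq (scan aSupport (Num 0) (Num 1))
       (Seq (CallL2 (Num 0) aSupport)
         (Seq (Store aNext (Num 0) (Reg rItems))
           (Seq (Assign rRun (Num 1))
             (While (Reg rRun) step))))"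

section \<open>Correctness and cost of the components\<close>

locale oracle_machine = oracle_instance V C I \<sigma> \<rho> \<delta> l1 l2 n q el item
  for V :: "'v set" and C and I :: "'i set" and \<sigma> \<rho> \<delta> l1 l2 n q el item +
  fixes t1 t2 t\<rho> :: nat
begin

text \<open>An array must hold the \<open>n * q\<close> incidence matrix or the \<open>n + 1\<close>
  entries of \<open>aNext\<close>, one per depth; the buffers, too, are numbered by the depths 0 to
  \<open>n\<close>.\<close>

definition M :: "'v machine" where
  "M = \<lparr>num = n, elem = el, oracle1 = l1, oracle2 = l2, positive = (\<lambda>X. \<rho> X > 0),
     time1 = t1, time2 = t2, time_pos = t\<rho>,
     capacity = (n + q) * n, num_bufs = n + 1, max_word = 2 * ((n + q) * n)\<rparr>"

lemma M_simps [simp]: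
  "num M = n" "elem M = el" "oracle1 M = l1" "oracle2 M = l2" "positive M X \<longleftrightarrow> \<rho> X > 0"
  "time1 M = t1" "time2 M = t2" "time_pos M = t\<rho>" "num_bufs M = n + 1"
  by (simp_all add: M_def)

lemma size_bound: "n * q + n * n = (n + q) * n" "n + 1 \<le> (n + q) * n" "q + 1 \<le> (n + q) * n"
    "n * q \<le> (n + q) * n"
proof -
  obtain a b where "n = Suc a" "q = Suc b"
    using n_pos q_pos by (metis Suc_le_D One_nat_def)
  then show "n + 1 \<le> (n + q) * n" "q + 1 \<le> (n + q) * n" by (auto simp: algebra_simps)
qed (auto simp: algebra_simps)

lemma index_less: "i < n \<Longrightarrow> j < q \<Longrightarrow> i * q + j < n * q"
  using mult_le_mono1[of "Suc i" n q] by simp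

lemma fits [simp]:
  "n \<le> capacity M" "n < max_word M" "q < max_word M" "Suc 0 \<le> max_word M"
  "x \<le> n \<Longrightarrow> x < capacity M" "x \<le> n \<Longrightarrow> x \<le> max_word M" "x \<le> n \<Longrightarrow> Suc x \<le> max_word M"
  "x \<le> q \<Longrightarrow> x \<le> max_word M" "x \<le> q \<Longrightarrow> Suc x \<le> max_word M"
  "i < n \<Longrightarrow> j < q \<Longrightarrow> i * q + j < capacity M"
  "i < n \<Longrightarrow> j < q \<Longrightarrow> i * q + j \<le> max_word M" "i < n \<Longrightarrow> i * q \<le> max_word M"
  using size_bound n_pos q_pos index_less[of i j]
    le_trans[OF mult_le_mono1[of i n q] size_bound(4)] by (simp_all add: M_def)

text \<open>The entries are exactly 0 and 1, because the program multiplies and compares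
  bits.\<close>

definition bits :: "(nat \<Rightarrow> nat) \<Rightarrow> 'v set \<Rightarrow> bool" where
  "bits b X \<longleftrightarrow> (\<forall>i<n. b i = (if el i \<in> X then 1 else 0))"

definition incidence :: "(nat \<Rightarrow> nat) \<Rightarrow> bool" where
  "incidence b \<longleftrightarrow> (\<forall>i<n. \<forall>j<q. b (i * q + j) = (if item j \<in> \<sigma> (el i) then 1 else 0))"

lemma el_image: "el ` {..<n} = V"
  using el by (simp add: bij_betw_def)

lemma el_V: "i < n \<Longrightarrow> el i \<in> V"
  using el_image by auto

lemma ex_el: "X \<subseteq> V \<Longrightarrow> (\<exists>i<n. el i \<in> X \<and> P (el i)) \<longleftrightarrow> (\<exists>v\<in>X. P v)"
  using el_image by force

lemma decode_bits:
  assumes "bits b X" "X \<subseteq> V"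
  shows "decode M b = X"
proof -
  have "{i. i < n \<and> b i \<noteq> 0} = {i. i < n \<and> el i \<in> X}" using assms(1) by (auto simp: bits_def split: if_splits)
  then show ?thesis using assms(2) el_image by (auto simp: decode_def)
qed

lemma bits_encode: "bits (encode M X b) X"
  by (simp add: bits_def encode_def)

lemma wp_scan_M:
  assumes "regs s rNum = n" "cost ec + cost ev \<le> 30"
    and "\<And>i x b t. i < n \<Longrightarrow> b i = arrs s a i \<Longrightarrow>
      safe M (s\<lparr>regs := (regs s)(rIndex := i, rFlag := x), arrs := (arrs s)(a := b), clock := t\<rparr>) ec \<and>
      val (s\<lparr>regs := (regs s)(rIndex := i, rFlag := x), arrs := (arrs s)(a := b), clock := t\<rparr>) ec = f i \<and>
      safe M (s\<lparr>regs := (regs s)(rIndex := i, rFlag := x), arrs := (arrs s)(a := b), clock := t\<rparr>) ev \<and>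
      val (s\<lparr>regs := (regs s)(rIndex := i, rFlag := x), arrs := (arrs s)(a := b), clock := t\<rparr>) ev = g i"
    and "\<And>t. clock s \<le> t \<Longrightarrow> t \<le> clock s + 100 * n \<Longrightarrow> Q (scanned n a f g s t)"
  shows "wp M (scan a ec ev) Q s"
  using assms n_pos by (intro wp_scan[where m = n and f = f and g = g]) auto

lemma ex_differ: "X \<subseteq> V \<Longrightarrow> Y \<subseteq> V \<Longrightarrow> (\<exists>i<n. (el i \<in> X) \<noteq> (el i \<in> Y)) \<longleftrightarrow> X \<noteq> Y"
  using el_image by blast

text \<open>What testing a candidate leaves intact: the path, the buffers, the outputs and the
  candidate itself.\<close>

definition agree :: "'v state \<Rightarrow> 'v state \<Rightarrow> bool" where
  "agree s s' \<longleftrightarrow>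
     (\<forall>r. r \<notin> {rIndex, rFlag, rPositive, rRejected, rItem, rAccept} \<longrightarrow> regs s' r = regs s r) \<and>
     (\<forall>a. a \<notin> {aSupport, aRestricted, aMaximal, aScratch} \<longrightarrow> arrs s' a = arrs s a) \<and>
     bufs s' = bufs s \<and> outs s' = outs s"

text \<open>The \<open>350 * n\<close> per item covers three passes of at most
  \<open>100 * n\<close> each, the transfer of sets to the oracle and constantly many steps;
  \<open>B\<close> is the time spent before the first item.\<close>

definition greedy_inv :: "'v set \<Rightarrow> 'v state \<Rightarrow> nat \<Rightarrow> nat \<Rightarrow> 'v state \<Rightarrow> bool" where
  "greedy_inv X s B k s' \<longleftrightarrow> agree s s' \<and> regs s' rItem = k \<and>
     regs s' rRejected = first_rejected X k \<and> bits (arrs s' aSupport) (supp (kept X k)) \<and>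
     clock s \<le> clock s' \<and> clock s' \<le> clock s + B + k * (t1 + 350 * n)"

lemma wp_greedy_step:
  assumes s: "regs s rNum = n" "regs s rItems = q" "incidence (arrs s aIncidence)"
      "bits (arrs s aCandidate) X" and X: "X \<in> C" "X \<noteq> {}"
    and k: "k < q" and inv: "greedy_inv X s B k s'"
  shows "wp M greedy_step (greedy_inv X s B (Suc k)) (tick 4 s')"
proof -
  have XV: "X \<subseteq> V" using C_sub X by auto
  let ?Y = "supp (insert k (kept X k))"
  have Y: "?Y = supp (kept X k) \<inter> supp {k}" by (auto simp: supp_def)
  have in_its: "k \<in> its X \<longleftrightarrow> \<not> (\<exists>i<n. el i \<in> X \<and> item k \<notin> \<sigma> (el i))"
    using k ex_el[OF XV, of "\<lambda>v. item k \<notin> \<sigma> v"] by (auto simp: its_def)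
  have XY: "k \<in> its X \<Longrightarrow> X \<subseteq> ?Y" using kept_sub XV by (intro sub_supp) auto
  define Z where "Z = l1 X ?Y"
  have ZV: "k \<in> its X \<Longrightarrow> Z \<subseteq> V"
    using l1_component[OF X XY supp_sub] supp_sub by (auto simp: Z_def max_components_def)
  note r = inv[unfolded greedy_inv_def agree_def]
  have rk: "first_rejected X k \<le> q" using first_rejected_le k by auto
  show ?thesis
    unfolding greedy_step_def
  proof (rule wp_Seq, rule wp_scan_M[where
        f = "\<lambda>i. if el i \<in> X \<and> item k \<notin> \<sigma> (el i) then 1 else 0" and
        g = "\<lambda>i. if el i \<in> ?Y then 1 else 0"], goal_cases)
    case (3 i x b t)
    then show ?case using r s k el_V[of i]
      by (auto simp: tick_def bits_def incidence_def Y supp_def)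
  next
    case (4 t)
    let ?s1 = "scanned n aRestricted (\<lambda>i. if el i \<in> X \<and> item k \<notin> \<sigma> (el i) then 1 else 0)
        (\<lambda>i. if el i \<in> ?Y then 1 else 0) (tick 4 s') t"
    have fl: "regs ?s1 rFlag = (if k \<in> its X then 0 else 1)"
      using in_its by (auto simp: scanned_def)
    have b1: "bits (arrs ?s1 aCandidate) X" "bits (arrs ?s1 aRestricted) ?Y"
      using s r by (auto simp: scanned_def bits_def tick_def)
    show ?case
    proof (rule wp_Seq, rule wp_If, goal_cases)
      case 2
      then have "k \<notin> its X" using fl by (auto split: if_splits)
      then show ?case using 4 r k n_pos
        by (intro wp_Skip wp_Assign) (auto simp: scanned_def state_defs greedy_inv_def agree_def)
    next
      case 3
      then have kX: "k \<in> its X" using fl by (auto split: if_splits)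
      have dec: "decode M (arrs ?s1 aCandidate) = X" "decode M (arrs ?s1 aRestricted) = ?Y"
        using decode_bits b1 XV supp_sub by auto
      show ?case
      proof (rule wp_Seq, rule wp_CallL1, goal_cases)
        case 3
        define s2 where "s2 = tick (1 + num M + time1 M) (set_vec M aMaximal Z (tick 2 ?s1))"
        have s2: "agree s s2" "regs s2 rItem = k" "regs s2 rRejected = first_rejected X k"
          "bits (arrs s2 aSupport) (supp (kept X k))" "bits (arrs s2 aRestricted) ?Y"
          "bits (arrs s2 aMaximal) Z" "bits (arrs s2 aCandidate) X"
          "clock s \<le> clock s2" "clock s2 \<le> clock s + B + k * (t1 + 350 * n) + t1 + 101 * n + 7"
          using r b1 4 bits_encode by (auto simp: s2_def state_defs scanned_def agree_def)
        note r2 = s2[unfolded agree_def]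
        have "wp M (scan aScratch (neg (Bin Equal (cell aMaximal) (cell aCandidate))) (Num 0))
           (wp M (If (Reg rFlag) (scan aSupport (Num 0) (cell aRestricted))
                    (If (Bin Equal (Reg rRejected) (Reg rItems)) (Assign rRejected (Reg rItem)) Skip))
           (wp M (Assign rItem (Bin Add (Reg rItem) (Num 1))) (greedy_inv X s B (Suc k)))) s2"
        proof (rule wp_scan_M[where f = "\<lambda>i. if (el i \<in> Z) \<noteq> (el i \<in> X) then 1 else 0" and
              g = "\<lambda>_. 0"], goal_cases)
          case (3 i x b t)
          then show ?case using r2 by (auto simp: bits_def)
        next
          case (4 t')
          let ?s3 = "scanned n aScratch (\<lambda>i. if (el i \<in> Z) \<noteq> (el i \<in> X) then 1 else 0) (\<lambda>_. 0) s2 t'"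
          have fl: "regs ?s3 rFlag = (if Z \<noteq> X then 1 else 0)"
            using ex_differ[OF ZV[OF kX] XV] by (auto simp: scanned_def)
          show ?case
          proof (rule wp_If, goal_cases)
            case 2
            then have ZX: "Z \<noteq> X" using fl by (auto split: if_splits)
            then have step: "kept X (Suc k) = insert k (kept X k)"
              "first_rejected X (Suc k) = first_rejected X k" using kX by (auto simp: Z_def)
            show ?case
            proof (rule wp_scan_M[where f = "\<lambda>_. 0" and g = "\<lambda>i. if el i \<in> ?Y then 1 else 0"], goal_cases)
              case (3 i x b t)
              then show ?case using r2 by (auto simp: scanned_def state_defs bits_def)
            next
              case (4 t'')
              then show ?case using r2 \<open>t' \<le> _\<close> \<open>clock s2 \<le> t'\<close> k n_pos unfolding greedy_inv_def step
                by (intro wp_Assign) (auto simp: scanned_def state_defs agree_def bits_def)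
            qed (use r2 s in \<open>auto simp: scanned_def tick_def\<close>)
          next
            case 3
            then have ZX: "Z = X" using fl by (auto split: if_splits)
            then have step: "kept X (Suc k) = kept X k"
              "first_rejected X (Suc k) = (if first_rejected X k = q then k else first_rejected X k)"
              using kX by (auto simp: Z_def)
            show ?case using r2 4 k n_pos s unfolding greedy_inv_def step
              by (intro wp_If wp_Assign wp_Skip) (auto simp: scanned_def state_defs agree_def)
          qed simp
        qed (use r2 s in auto)
        then show ?case using dec Z_def by (intro wp_Seq) (simp add: s2_def tick_def)
      qed (use dec X XY[OF kX] in \<open>auto simp: tick_def\<close>)
    qed simp
  qed (use r s in \<open>auto simp: tick_def\<close>)
qed

lemma wp_greedy:
  assumes s: "regs s rNum = n" "regs s rItems = q" "incidence (arrs s aIncidence)"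
      "bits (arrs s aCandidate) X" and X: "X \<in> C" "X \<noteq> {}"
    and Q: "\<And>s'. agree s s' \<Longrightarrow> regs s' rRejected = first_rejected X q \<Longrightarrow>
      bits (arrs s' aMaximal) (parent X) \<Longrightarrow> clock s \<le> clock s' \<Longrightarrow>
      clock s' \<le> clock s + q * (t1 + 350 * n) + t1 + 200 * n \<Longrightarrow> Q s'"
  shows "wp M greedy Q s"
  unfolding greedy_def
proof (rule wp_Seq, rule wp_scan_M[where f = "\<lambda>_. 0" and g = "\<lambda>_. 1"], goal_cases)
  case (4 t)
  have XV: "X \<subseteq> V" using C_sub X by auto
  show ?case
  proof (intro wp_Seq wp_Assign wp_While_count[where J = "greedy_inv X s (100 * n + 4)" and m = q], goal_cases)
    case 3
    show ?case using 4 s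
      by (auto simp: greedy_inv_def agree_def scanned_def state_defs bits_def supp_def el_V)
  next
    case (4 k s')
    have c: "1 + cost (Bin Less (Reg rItem) (Reg rItems)) = 4" by simp
    have "regs s' rItem = k" "regs s' rItems = q" using 4 s by (simp_all add: greedy_inv_def agree_def)
    then show ?case using wp_greedy_step[OF s X 4] 4(1) unfolding c by simp
  next
    case (5 s')
    note r = 5[unfolded greedy_inv_def agree_def]
    let ?Y = "supp (kept X q)"
    have dec: "decode M (arrs s' aCandidate) = X" "decode M (arrs s' aSupport) = ?Y"
      using decode_bits XV supp_sub r s by auto
    have "X \<subseteq> ?Y" using kept_sub XV by (intro sub_supp)
    then have "wp M (CallL1 aCandidate aSupport aMaximal) Q
        (tick (1 + cost (Bin Less (Reg rItem) (Reg rItems))) s')"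
      using dec X r n_pos
      by (intro wp_CallL1 Q) (auto simp: state_defs agree_def bits_encode parent_def)
    then show ?case using r s by simp
  qed (use s in \<open>auto simp: scanned_def state_defs\<close>)
qed (use s in auto)

section \<open>The path stored in the marks, and the treatment of one candidate, item or
  level\<close>

definition level :: "'v state \<Rightarrow> nat \<Rightarrow> 'v set" where
  "level s e = el ` {i. i < n \<and> e \<le> arrs s aLevel i}"

lemma level_iff: "i < n \<Longrightarrow> el i \<in> level s e \<longleftrightarrow> e \<le> arrs s aLevel i"
  using el by (auto simp: level_def bij_betw_def inj_on_def)

lemma level_sub: "level s e \<subseteq> V"
  using el_V by (auto simp: level_def)

lemma level_0: "level s 0 = V"
  using el_image by (auto simp: level_def)

lemma level_cong: "arrs s' aLevel = arrs s aLevel \<Longrightarrow> level s' = level s"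
  by (simp add: level_def fun_eq_iff)

text \<open>\<open>aNext\<close> points one past the item whose candidates fill the buffer. At depth
  0 the buffer contains maximal components of \<open>V\<close>, which are solutions, so
  \<open>good\<close> is all that remains to be checked.\<close>

definition acceptable :: "'v state \<Rightarrow> nat \<Rightarrow> 'v set \<Rightarrow> bool" where
  "acceptable s e X \<longleftrightarrow>
     (if e = 0 then good X else arrs s aNext e \<ge> 1 \<and> is_kid (level s e) (arrs s aNext e - 1) X)"

abbreviation accepted :: "'v state \<Rightarrow> 'v set \<Rightarrow> bool" where
  "accepted s \<equiv> acceptable s (regs s rDepth)"

lemma acceptable_good: "acceptable s e X \<Longrightarrow> good X"
  by (auto simp: acceptable_def is_kid_def split: if_splits)

lemma acceptable_cong:
  "level s' e = level s e \<Longrightarrow> arrs s' aNext e = arrs s aNext e \<Longrightarrow>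
    acceptable s' e = acceptable s e"
  by (simp add: acceptable_def fun_eq_iff)

lemma wp_check:
  assumes s: "regs s rNum = n" "regs s rItems = q" "incidence (arrs s aIncidence)"
      "bits (arrs s aCandidate) X" "regs s rDepth \<le> n" and X: "X \<in> C" "good X"
    and Q: "\<And>s'. agree s s' \<Longrightarrow> regs s' rAccept = (if accepted s X then 1 else 0) \<Longrightarrow>
      clock s \<le> clock s' \<Longrightarrow> clock s' \<le> clock s + q * (t1 + 350 * n) + t1 + 320 * n \<Longrightarrow> Q s'"
  shows "wp M check Q s"
  unfolding check_def
proof (rule wp_If, goal_cases)
  case 2
  let ?d = "regs s rDepth"
  have d: "?d \<noteq> 0" using 2 by simp
  have Xne: "X \<noteq> {}" using X by (simp add: good_def)
  let ?P = "parent X" and ?Y = "level s ?d"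
  have PV: "?P \<subseteq> V" using parent_superset(1)[OF X(1) Xne] supp_sub by (auto simp: max_components_iff)
  show ?case
  proof (rule wp_Seq, rule wp_greedy[OF _ _ _ _ X(1) Xne], goal_cases)
    case (5 s1)
    note r1 = 5(1)[unfolded agree_def]
    show ?case
    proof (rule wp_Seq, rule wp_scan_M[where g = "\<lambda>_. 0" and
          f = "\<lambda>i. if (el i \<in> ?P) \<noteq> (el i \<in> ?Y) then 1 else 0"], goal_cases)
      case (3 i x b t)
      then show ?case using r1 s 5(3) level_iff[of i s ?d]
        by (auto simp: state_defs bits_def)
    next
      case (4 t)
      define s2 where "s2 = scanned n aScratch (\<lambda>i. if (el i \<in> ?P) \<noteq> (el i \<in> ?Y) then 1 else 0) (\<lambda>_. 0) s1 t"
      let ?e = "Bin Mul (Bin Equal (Bin Add (Reg rRejected) (Num 1)) next_index) (neg (Reg rFlag))"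
      have fl: "regs s2 rFlag = (if ?P \<noteq> ?Y then 1 else 0)"
        using ex_differ[OF PV level_sub[of s ?d]] by (auto simp: s2_def scanned_def)
      have r2: "regs s2 rRejected = first_rejected X q"
        "regs s2 rDepth = ?d" "arrs s2 aNext = arrs s aNext"
        using r1 5 by (simp_all add: s2_def scanned_def state_defs)
      have "first_rejected X q \<le> q" using first_rejected_le by simp
      then have safe: "safe M s2 ?e" using s(5) by (simp add: r2 fl)
      have "(arrs s aNext ?d = Suc (first_rejected X q)) =
          (arrs s aNext ?d \<ge> 1 \<and> first_rejected X q = arrs s aNext ?d - 1)" by arith
      then have "accepted s X \<longleftrightarrow> arrs s aNext ?d = Suc (first_rejected X q) \<and> ?P = ?Y"
        using d X(2) unfolding acceptable_def is_kid_def by (simp only: if_False simp_thms) argo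
      then have val: "val s2 ?e = (if accepted s X then 1 else 0)" by (simp add: r2 fl)
      have "agree s (tick (1 + cost ?e) (set_reg rAccept (if accepted s X then 1 else 0) s2))"
        using r1 by (simp add: s2_def state_defs scanned_def agree_def)
      then have "wp M (Assign rAccept ?e) Q s2"
        using 4 5(4,5) n_pos safe by (intro wp_Assign Q) (simp_all only: val, simp_all add: s2_def state_defs scanned_def)
      then show ?case by (simp only: s2_def)
    qed (use r1 s in \<open>auto simp: state_defs\<close>)
  qed (use s in \<open>auto simp: state_defs\<close>)
next
  case 3
  then show ?case using s X n_pos
    by (intro wp_Assign Q) (auto simp: state_defs agree_def acceptable_def)
qed simp

text \<open>\<open>t\<close> is the moment of the possible output, which precedes the end of the
  step; the delay is measured from it.\<close>

definition pushed :: "'v state \<Rightarrow> 'v set \<Rightarrow> nat \<Rightarrow> 'v state \<Rightarrow> bool" where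
  "pushed s X t s' \<longleftrightarrow>
     (\<forall>r\<in>{rNum, rItems, rRun}. regs s' r = regs s r) \<and>
     regs s' rDepth = Suc (regs s rDepth) \<and> regs s' rParity = 1 - regs s rParity \<and>
     arrs s' aIncidence = arrs s aIncidence \<and>
     arrs s' aNext = (arrs s aNext)(Suc (regs s rDepth) := 0) \<and>
     (\<forall>i<n. arrs s' aLevel i \<le> n) \<and> level s' (Suc (regs s rDepth)) = X \<and>
     (\<forall>e\<le>regs s rDepth. level s' e = level s e) \<and>
     bufs s' = bufs s \<and> clock s \<le> t \<and> t \<le> clock s' \<and>
     outs s' = outs s @ (if regs s rParity = 0 then [(t, X)] else [])"

lemma wp_push:
  assumes s: "regs s rNum = n" "bits (arrs s aCandidate) X" "regs s rDepth < n" "regs s rParity \<le> 1"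
      "\<And>i. i < n \<Longrightarrow> arrs s aLevel i \<le> n" and X: "X \<subseteq> level s (regs s rDepth)"
    and Q: "\<And>s' t. pushed s X t s' \<Longrightarrow> clock s' \<le> clock s + 120 * n \<Longrightarrow> Q s'"
  shows "wp M push Q s"
  unfolding push_def
proof (rule wp_Seq, rule wp_scan_M[where f = "\<lambda>_. 0" and
      g = "\<lambda>i. min (arrs s aLevel i) (regs s rDepth) + (if el i \<in> X then 1 else 0)"], goal_cases)
  case (3 i x b t)
  have "arrs s aLevel i - regs s rDepth \<le> n" "arrs s aLevel i \<le> n"
    using s(5)[of i] 3 by simp_all
  then show ?case using 3 s(2,3) by (auto simp: bits_def min_def)
next
  case (4 t)
  let ?d = "regs s rDepth" and ?g = "\<lambda>i. min (arrs s aLevel i) (regs s rDepth) + (if el i \<in> X then 1 else 0)"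
  have XV: "X \<subseteq> V" using X level_sub by blast
  have dec: "decode M (arrs s aCandidate) = X" using decode_bits s XV by auto
  have Xi: "\<And>i. i < n \<Longrightarrow> el i \<in> X \<Longrightarrow> ?d \<le> arrs s aLevel i" using X level_iff by blast
  \<comment> \<open>Capping at the depth erases marks left by sets popped earlier, which
    \<open>pop\<close> does not touch. Adding the bit of \<open>X\<close> yields the mark
    \<open>Suc ?d\<close> because \<open>X\<close> lies in the set on top.\<close>
  have lev: "level s' (Suc ?d) = X \<and> (\<forall>e\<le>?d. level s' e = level s e) \<and> (\<forall>i<n. arrs s' aLevel i \<le> n)"
    if a: "arrs s' aLevel = (\<lambda>i. if i < n then ?g i else arrs s aLevel i)" for s' :: "'v state"
  proof (intro conjI allI impI)
    have "{i. i < n \<and> Suc ?d \<le> arrs s' aLevel i} = {i. i < n \<and> el i \<in> X}"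
      using Xi by (auto simp: a split: if_splits)
    then show "level s' (Suc ?d) = X" using XV el_image by (auto simp: level_def)
    show "level s' e = level s e" if "e \<le> ?d" for e
      using that Xi unfolding level_def by (intro arg_cong[where f = "image el"]) (auto simp: a intro: le_trans)
    show "arrs s' aLevel i \<le> n" if "i < n" for i using that s by (auto simp: a)
  qed
  show ?case
  proof (intro wp_Seq wp_Assign wp_Store wp_If wp_Output wp_Skip, goal_cases)
    case 7
    then show ?case using s(2-4) dec 4 n_pos lev
      by (intro Q[where t = "t + 14 + n"]) (auto simp: pushed_def state_defs scanned_def)
  next
    case 8
    then show ?case using s(2-4) dec 4 n_pos lev
      by (intro Q[where t = t]) (auto simp: pushed_def state_defs scanned_def)
  qed (use s(3,4) in \<open>auto simp: state_defs scanned_def\<close>)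
qed (use s in auto)

lemma agree_trans: "agree s s' \<Longrightarrow> agree s' s'' \<Longrightarrow> agree s s''"
  by (simp add: agree_def)

lemma agree_level: "agree s s' \<Longrightarrow> level s' = level s"
  by (intro level_cong) (simp add: agree_def)

lemma agree_accepted: "agree s s' \<Longrightarrow> accepted s' = accepted s"
  using agree_level[of s s'] by (simp add: acceptable_def agree_def fun_eq_iff)

lemma agree_pushed: "agree s s1 \<Longrightarrow> clock s \<le> clock s1 \<Longrightarrow> pushed s1 X t s' \<Longrightarrow> pushed s X t s'"
  using agree_level[of s s1] by (simp add: pushed_def agree_def)

text \<open>Non-emptiness is tested before \<open>check\<close>, which needs it for calling the
  first oracle. The assumption \<open>depth\<close> guarantees room for one more level.\<close>

lemma wp_try_candidate:
  assumes s: "regs s rNum = n" "regs s rItems = q" "incidence (arrs s aIncidence)"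
      "bits (arrs s aCandidate) X" "regs s rDepth \<le> n" "regs s rParity \<le> 1"
      "\<And>i. i < n \<Longrightarrow> arrs s aLevel i \<le> n" and X: "X \<in> C" "X \<subseteq> level s (regs s rDepth)"
    and depth: "accepted s X \<Longrightarrow> regs s rDepth < n"
    and reject: "\<And>s'. agree s s' \<Longrightarrow> \<not> accepted s X \<Longrightarrow>
      clock s' \<le> clock s + q * (t1 + 350 * n) + t1 + t\<rho> + 570 * n \<Longrightarrow> Q s'"
    and accept: "\<And>t s'. pushed s X t s' \<Longrightarrow> accepted s X \<Longrightarrow>
      clock s' \<le> clock s + q * (t1 + 350 * n) + t1 + t\<rho> + 570 * n \<Longrightarrow> Q s'"
  shows "wp M try_candidate Q s"
  unfolding try_candidate_def
proof (rule wp_Seq, rule wp_scan_M[where f = "\<lambda>i. if el i \<in> X then 1 else 0" and g = "\<lambda>_. 0"], goal_cases)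
  case (3 i x b t)
  then show ?case using s(4) by (simp add: bits_def)
next
  case (4 t)
  have XV: "X \<subseteq> V" using C_sub X by auto
  define s1 where "s1 = scanned n aScratch (\<lambda>i. if el i \<in> X then 1 else 0) (\<lambda>_. 0) s t"
  have fl: "regs s1 rFlag = (if X \<noteq> {} then 1 else 0)"
    using ex_el[OF XV, of "\<lambda>_. True"] by (auto simp: s1_def scanned_def)
  have a1: "agree s s1" "clock s1 = t" by (simp_all add: s1_def agree_def scanned_def)
  have "arrs s1 aCandidate = arrs s aCandidate" using a1 by (simp add: agree_def)
  then have dec: "decode M (arrs s1 aCandidate) = X" using decode_bits[OF s(4) XV] by simp
  have "wp M (If (Reg rFlag)
         (Seq (TestPositive rPositive aCandidate)
           (If (Reg rPositive) (Seq check (If (Reg rAccept) push Skip)) Skip))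
         Skip) Q s1"
  proof (rule wp_If, goal_cases)
    case 2
    show ?case
    proof (rule wp_Seq, rule wp_TestPositive, goal_cases)
      case 1
      define s2 where "s2 = tick (1 + n + t\<rho>) (set_reg rPositive (if \<rho> X > 0 then 1 else 0) (tick 2 s1))"
      have a2: "agree s s2" "clock s2 = t + 3 + n + t\<rho>"
        "regs s2 rPositive = (if \<rho> X > 0 then 1 else 0)"
        using a1 by (simp_all add: s2_def agree_def state_defs)
      have "wp M (If (Reg rPositive) (Seq check (If (Reg rAccept) push Skip)) Skip) Q s2"
      proof (rule wp_If, goal_cases)
        case 2
        let ?s3 = "tick (1 + cost (Reg rPositive)) s2"
        have good: "good X"
          using 2 a2 fl \<open>val s1 (Reg rFlag) \<noteq> 0\<close> by (auto simp: good_def split: if_splits)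
        have a3: "agree s ?s3" using a2 by (simp add: agree_def tick_def)
        note r3 = a3[unfolded agree_def]
        show ?case
        proof (rule wp_Seq, rule wp_check[OF _ _ _ _ _ X(1) good], goal_cases)
          case (6 s4)
          have a4: "agree s s4" using agree_trans[OF a3 6(1)] .
          note r4 = a4[unfolded agree_def]
          have acc: "regs s4 rAccept = (if accepted s X then 1 else 0)"
            using 6(2) agree_accepted[OF a3] by simp
          have c4: "clock s4 \<le> t + 5 + n + t\<rho> + q * (t1 + 350 * n) + t1 + 320 * n" "t \<le> clock s4"
            using 6(3,4) a2 by (simp_all add: tick_def)
          show ?case
          proof (rule wp_If, goal_cases)
            case 2
            then have accepted: "accepted s X" using acc by (simp split: if_splits)
            let ?s5 = "tick (1 + cost (Reg rAccept)) s4"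
            have a5: "agree s ?s5" "clock s \<le> clock ?s5" using a4 c4 4 by (simp_all add: agree_def tick_def)
            note r5 = a5(1)[unfolded agree_def]
            show ?case
            proof (rule wp_push[where X = X], goal_cases)
              case (7 s' t')
              show ?case using agree_pushed[OF a5 7(1)] accepted
                by (rule accept) (use 7(2) c4 4(2) n_pos in \<open>simp add: tick_def\<close>)
            qed (use s r5 depth[OF accepted] X agree_level[OF a5(1)] in simp_all)
          next
            case 3
            then have "\<not> accepted s X" using acc by (simp split: if_splits)
            then show ?case using a4 c4 4(2) n_pos
              by (intro wp_Skip reject) (simp_all add: agree_def tick_def)
          qed simp
        qed (use s r3 in simp_all)
      next
        case 3
        then have "\<not> accepted s X" using a2 acceptable_good by (auto simp: good_def)
        then show ?case using a2 4(2) n_pos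
          by (intro wp_Skip reject) (simp_all add: agree_def tick_def)
      qed simp
      then show ?case using dec by (simp add: s2_def tick_def)
    qed
  next
    case 3
    then have "\<not> accepted s X" using fl acceptable_good by (auto simp: good_def split: if_splits)
    then show ?case using a1 4(2) n_pos
      by (intro wp_Skip reject) (simp_all add: agree_def tick_def)
  qed simp
  then show ?case by (simp only: s1_def)
qed (use s in simp_all)

lemma wp_next_item:
  assumes s: "regs s rNum = n" "regs s rItems = q" "incidence (arrs s aIncidence)"
      "regs s rDepth = d" "d \<le> n" "arrs s aNext d = j" "j < q" "bufs s d = []"
    and Q: "\<And>s'. (\<And>r. r \<le> 4 \<Longrightarrow> regs s' r = regs s r) \<Longrightarrow>
      arrs s' aIncidence = arrs s aIncidence \<Longrightarrow> arrs s' aLevel = arrs s aLevel \<Longrightarrow>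
      arrs s' aNext = (arrs s aNext)(d := Suc j) \<Longrightarrow>
      bufs s' = (bufs s)(d := candidates (level s d) j) \<Longrightarrow> outs s' = outs s \<Longrightarrow>
      clock s \<le> clock s' \<Longrightarrow> clock s' \<le> clock s + t2 + 240 * n \<Longrightarrow> Q s'"
  shows "wp M next_item Q s"
  unfolding next_item_def
proof (rule wp_Seq, rule wp_scan_M[where
      f = "\<lambda>i. if el i \<in> level s d \<inter> supp {j} then 1 else 0" and
      g = "\<lambda>i. if el i \<in> level s d \<inter> supp {j} then 1 else 0"], goal_cases)
  case (3 i x b t)
  then show ?case using s(2-7) level_iff[of i s d] el_V[of i]
    by (auto simp: incidence_def supp_def)
next
  case (4 t)
  let ?Y = "level s d" and ?g = "\<lambda>i. if el i \<in> level s d \<inter> supp {j} then 1 else (0 :: nat)"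
  let ?U = "?Y \<inter> supp {j}"
  have UV: "?U \<subseteq> V" using supp_sub by auto
  define s1 where "s1 = scanned n aRestricted ?g ?g s t"
  define ok where "ok s' \<longleftrightarrow> (\<forall>r\<le>4. regs s' r = regs s r) \<and>
      (\<forall>a. a \<notin> {aRestricted, aScratch} \<longrightarrow> arrs s' a = arrs s a) \<and> outs s' = outs s \<and> clock s \<le> clock s'"
    for s' :: "'v state"
  have ok1: "ok s1" "bufs s1 = bufs s" "clock s1 \<le> clock s + 100 * n" "bits (arrs s1 aRestricted) ?U"
    using 4 by (simp_all add: ok_def s1_def scanned_def bits_def)
  have fl: "regs s1 rFlag = (if ?U \<noteq> {} then 1 else 0)"
    using ex_el[OF UV, of "\<lambda>_. True"] by (auto simp: s1_def scanned_def)
  have final: "wp M (Store aNext (Reg rDepth) (Bin Add next_index (Num 1))) Q s'"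
    if "ok s'" "bufs s' = (bufs s)(d := candidates ?Y j)" "clock s' \<le> clock s + t2 + 230 * n"
    for s'
  proof (rule wp_Store, goal_cases)
    case 4
    show ?case by (rule Q) (use that s(4-7) n_pos in \<open>simp_all add: ok_def state_defs\<close>)
  qed (use that s(4-7) in \<open>simp_all add: ok_def\<close>)
  \<comment> \<open>If the oracle is not called, the buffer must already equal the empty list of
    candidates.\<close>
  have empty: "bufs s = (bufs s)(d := [])" using s(8) by auto
  have "wp M (Seq (If (Reg rFlag)
              (Seq (scan aScratch (Bin Mul at_level (neg (present next_index))) (Num 0))
                (If (Reg rFlag) (CallL2 (Reg rDepth) aRestricted) Skip))
              Skip)
         (Store aNext (Reg rDepth) (Bin Add next_index (Num 1)))) Q s1"
  proof (rule wp_Seq, rule wp_If, goal_cases)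
    case 2
    then have U: "?U \<noteq> {}" using fl by (auto split: if_splits)
    let ?s2 = "tick (1 + cost (Reg rFlag)) s1"
    have ok2: "ok ?s2" "bufs ?s2 = bufs s" "clock ?s2 \<le> clock s + 100 * n + 2"
        "bits (arrs ?s2 aRestricted) ?U"
      using ok1 by (simp_all add: ok_def tick_def)
    note r2 = ok2(1)[unfolded ok_def]
    show ?case
    proof (rule wp_Seq, rule wp_scan_M[where
      f = "\<lambda>i. if el i \<in> ?Y \<and> item j \<notin> \<sigma> (el i) then 1 else 0" and g = "\<lambda>_. 0"], goal_cases)
      case (3 i x b t)
      then show ?case using r2 s(2-7) level_iff[of i s d]
        by (auto simp: incidence_def)
    next
      case (4 t')
      define s3 where "s3 = scanned n aScratch (\<lambda>i. if el i \<in> ?Y \<and> item j \<notin> \<sigma> (el i) then 1 else 0) (\<lambda>_. 0) ?s2 t'"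
      have ok3: "ok s3" "bufs s3 = bufs s" "clock s3 \<le> clock s + 200 * n + 2"
        "bits (arrs s3 aRestricted) ?U"
        using ok2 4 by (simp_all add: ok_def s3_def scanned_def)
      have "j \<in> its ?Y \<longleftrightarrow> \<not> (\<exists>i<n. el i \<in> ?Y \<and> item j \<notin> \<sigma> (el i))"
        using ex_el[OF level_sub[of s d], of "\<lambda>v. item j \<notin> \<sigma> v"] s(7) by (auto simp: its_def)
      then have fl3: "regs s3 rFlag = (if j \<notin> its ?Y then 1 else 0)"
        by (auto simp: s3_def scanned_def)
      have dec: "decode M (arrs s3 aRestricted) = ?U" using decode_bits[OF ok3(4) UV] .
      note r3 = ok3(1)[unfolded ok_def]
      have "wp M (If (Reg rFlag) (CallL2 (Reg rDepth) aRestricted) Skip)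
          (wp M (Store aNext (Reg rDepth) (Bin Add next_index (Num 1))) Q) s3"
      proof (rule wp_If, goal_cases)
        case 2
        then have "candidates ?Y j = l2 ?U" using fl3 U by (auto simp: candidates_def split: if_splits)
        then show ?case using r3 ok3(2,3) dec U s(4,5) n_pos
          by (intro wp_CallL2 final) (simp_all add: ok_def state_defs)
      next
        case 3
        then have "candidates ?Y j = []" using fl3 by (auto simp: candidates_def split: if_splits)
        then show ?case using r3 ok3(2,3) empty n_pos
          by (intro wp_Skip final) (simp_all add: ok_def state_defs)
      qed simp
      then show ?case by (simp only: s3_def)
    qed (use r2 s in simp_all)
  next
    case 3
    then have "candidates ?Y j = []" using fl by (auto simp: candidates_def split: if_splits)
    then show ?case using ok1 empty n_pos
      by (intro wp_Skip final) (simp_all add: ok_def state_defs)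
  qed simp
  then show ?case by (simp only: s1_def)
qed (use s in simp_all)

lemma wp_pop:
  assumes s: "regs s rNum = n" "regs s rDepth = d" "d \<le> n" "d > 0" "regs s rParity = d mod 2"
    and Q: "\<And>s' t. (\<And>r. r \<in> {rNum, rItems, rRun} \<Longrightarrow> regs s' r = regs s r) \<Longrightarrow>
      regs s' rDepth = d - 1 \<Longrightarrow> regs s' rParity = (d - 1) mod 2 \<Longrightarrow>
      (\<And>a. a \<noteq> aScratch \<Longrightarrow> arrs s' a = arrs s a) \<Longrightarrow> bufs s' = bufs s \<Longrightarrow>
      clock s \<le> t \<Longrightarrow> t \<le> clock s' \<Longrightarrow> clock s' \<le> clock s + 130 * n \<Longrightarrow>
      outs s' = outs s @ (if even d then [(t, level s d)] else []) \<Longrightarrow> Q s'"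
  shows "wp M pop Q s"
  unfolding pop_def
proof (rule wp_If, goal_cases)
  case 2
  define ok where "ok t s' \<longleftrightarrow> (\<forall>r\<in>{rNum, rItems, rRun, rDepth, rParity}. regs s' r = regs s r) \<and>
      (\<forall>a. a \<noteq> aScratch \<longrightarrow> arrs s' a = arrs s a) \<and> bufs s' = bufs s \<and>
      clock s \<le> t \<and> t \<le> clock s' \<and> clock s' \<le> clock s + 110 * n + 10 \<and>
      outs s' = outs s @ (if even d then [(t, level s d)] else [])" for t and s' :: "'v state"
  have par: "Suc 0 - d mod 2 = (d - Suc 0) mod 2" using s(4) by (cases d) (simp_all add: mod_Suc)
  have final: "wp M (Seq (Assign rDepth (Bin Sub (Reg rDepth) (Num 1))) (Assign rParity (neg (Reg rParity)))) Q s'"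
    if "ok t s'" for t s'
  proof (intro wp_Seq wp_Assign, goal_cases)
    case 3
    show ?case by (rule Q[of _ t]) (use that par s(2-5) n_pos in \<open>auto simp: ok_def state_defs\<close>)
  qed (use that s in \<open>simp_all add: ok_def state_defs\<close>)
  show ?case
  proof (rule wp_Seq, rule wp_If, goal_cases)
    case 2
    then have "odd d" using s by (simp add: tick_def odd_iff_mod_2_eq_one)
    then show ?case by (intro wp_Skip final[of "clock s"]) (simp add: ok_def state_defs)
  next
    case 3
    then have ev: "even d" using s by (simp add: tick_def even_iff_mod_2_eq_zero)
    show ?case
    proof (rule wp_Seq, rule wp_scan_M[where f = "\<lambda>_. 0" and
        g = "\<lambda>i. if el i \<in> level s d then 1 else 0"], goal_cases)
      case (3 i x b t)
      then show ?case using s level_iff[of i s d] by (simp add: state_defs)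
    next
      case (4 t)
      have "decode M (\<lambda>i. if i < n then if el i \<in> level s d then 1 else 0 else b i) = level s d" for b
        by (rule decode_bits) (simp_all add: bits_def level_sub)
      then show ?case using 4 ev n_pos
        by (intro wp_Output final[of "t + 1 + n"]) (simp add: ok_def state_defs scanned_def)
    qed (use s in \<open>simp_all add: tick_def\<close>)
  qed simp
qed (use s in simp_all)

section \<open>Amortised analysis of the traversal\<close>

text \<open>Prices in three tiers: an item prepays all candidates that its oracle call may return, a
  node prepays all its items. The further \<open>\<delta> V * candidate_cost\<close> of a node is
  for candidates already in its buffer when work on it resumes.\<close>

definition candidate_cost :: nat where
  "candidate_cost = q * (t1 + 350 * n) + t1 + t\<rho> + 600 * n"

definition item_cost :: nat where
  "item_cost = t2 + 300 * n + \<delta> V * candidate_cost"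

definition node_cost :: nat where
  "node_cost = q * item_cost + \<delta> V * candidate_cost + 300 * n"

definition base :: "'v state \<Rightarrow> bool" where
  "base s \<longleftrightarrow>
     regs s rNum = n \<and> regs s rItems = q \<and> regs s rRun = 1 \<and>
     regs s rDepth \<le> n \<and> regs s rParity = regs s rDepth mod 2 \<and>
     incidence (arrs s aIncidence) \<and> (\<forall>i<n. arrs s aLevel i \<le> n)"

text \<open>Every level loses an element, which the sum of cardinality and depth records; since
  nodes are non-empty, it bounds the depth by \<open>n\<close>.\<close>

definition level_ok :: "'v state \<Rightarrow> nat \<Rightarrow> bool" where
  "level_ok s e \<longleftrightarrow> length (bufs s e) \<le> \<delta> V \<and> arrs s aNext e \<le> q \<and>
     (if e = 0 then arrs s aNext e = q \<and> (\<forall>X\<in>set (bufs s e). X \<in> max_components C V)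
      else level s e \<in> nodes \<and> card (level s e) + e \<le> n + 1 \<and>
        (\<forall>X\<in>set (bufs s e).
           arrs s aNext e \<ge> 1 \<and> X \<in> set (candidates (level s e) (arrs s aNext e - 1))))"

text \<open>Buffers above the current depth are empty, so a pushed set starts with an empty
  buffer.\<close>

definition path :: "'v state \<Rightarrow> bool" where
  "path s \<longleftrightarrow> base s \<and> (\<forall>e\<le>regs s rDepth. level_ok s e) \<and> (\<forall>e>regs s rDepth. bufs s e = [])"

text \<open>The outputs due at depth \<open>e\<close> once its buffer is used up. The flag
  \<open>even e\<close> belongs to a child, whose depth \<open>e + 1\<close> is then odd.\<close>

definition rest :: "'v state \<Rightarrow> nat \<Rightarrow> 'v set list" where
  "rest s e =
     (if e = 0 then []
      else concat (map (\<lambda>j. concat (map (subtree (n - e) (even e)) (kids (level s e) j)))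
             [arrs s aNext e..<q]) @
        (if even e then [level s e] else []))"

definition frame :: "'v state \<Rightarrow> nat \<Rightarrow> 'v set list" where
  "frame s e = concat (map (subtree (n - e) (even e)) (filter (acceptable s e) (bufs s e))) @ rest s e"

definition below :: "'v state \<Rightarrow> nat \<Rightarrow> 'v set list" where
  "below s d = concat (map (frame s) (rev [0..<d]))"

text \<open>The complete future output, top of the path first. As an exact list it is either
  preserved by a step or loses its head.\<close>

definition pending :: "'v state \<Rightarrow> 'v set list" where
  "pending s = below s (Suc (regs s rDepth))"

text \<open>At odd depth the set on top of the path has been output already, so the next output may be
  delayed by one further node, the parent or a child, which has even depth and no output yet or
  only at its end. At even depth it is due at the latest when the set on top is left.\<close>

definition potential :: "'v state \<Rightarrow> nat" where
  "potential s =
     (let d = regs s rDepth in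
      (q - arrs s aNext d) * item_cost + length (bufs s d) * candidate_cost + 300 * n +
      (if odd d then node_cost else 0))"

text \<open>Right after an output the potential is worth at most two nodes; the other terms cover
  the end of the step that made it, a push (\<open>candidate_cost\<close>) or a pop
  (\<open>300 * n\<close>).\<close>

definition max_delay :: nat where
  "max_delay = 2 * node_cost + candidate_cost + 300 * n"

text \<open>Silent, output and final steps. In a silent step the potential drops, which yields
  termination, and time plus potential does not grow. The 2 in the final case reserves the last
  evaluation of the loop condition.\<close>

definition progress :: "'v state \<Rightarrow> 'v state \<Rightarrow> bool" where
  "progress s s' \<longleftrightarrow>
     path s' \<and> outs s' = outs s \<and> pending s' = pending s \<and>
       clock s' + potential s' \<le> clock s + potential s \<and> potential s' < potential s \<or>
     path s' \<and> (\<exists>t X. outs s' = outs s @ [(t, X)] \<and> pending s = X # pending s' \<and>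
       clock s \<le> t \<and> t \<le> clock s + potential s \<and> t \<le> clock s' \<and>
       clock s' + potential s' \<le> t + max_delay) \<or>
     regs s' rRun = 0 \<and> outs s' = outs s \<and> pending s = [] \<and> clock s' + 2 \<le> clock s + potential s"

section \<open>Every step respects the future output and pays from the potential\<close>

lemma below_Suc: "below s (Suc d) = frame s d @ below s d"
  by (simp add: below_def)

lemma frame_cong:
  "level s' e = level s e \<Longrightarrow> arrs s' aNext e = arrs s aNext e \<Longrightarrow> bufs s' e = bufs s e \<Longrightarrow>
    frame s' e = frame s e"
  using acceptable_cong[of s' e s] by (simp add: frame_def rest_def)

lemma level_ok_mono:
  assumes "level_ok s e" "level s' e = level s e" "arrs s' aNext e = arrs s aNext e"
    "length (bufs s' e) \<le> length (bufs s e)" "set (bufs s' e) \<subseteq> set (bufs s e)"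
  shows "level_ok s' e"
  using assms unfolding level_ok_def by (cases "e = 0") (simp_all only: if_True if_False, auto)

lemma below_cong: "(\<And>e. e < d \<Longrightarrow> frame s' e = frame s e) \<Longrightarrow> below s' d = below s d"
  unfolding below_def by (rule arg_cong[where f = concat], rule map_cong) auto

lemma mod_Suc_eq_one: "Suc d mod 2 = 1 - d mod 2"
  by (simp add: mod_Suc)

lemma costs_pos: "candidate_cost \<ge> 1" "candidate_cost \<le> item_cost" "candidate_cost \<le> node_cost"
  "300 * n \<le> node_cost"
proof -
  show "candidate_cost \<ge> 1" using n_pos by (simp add: candidate_cost_def)
  have "candidate_cost \<le> \<delta> V * candidate_cost"
    using mult_le_mono1[OF \<delta>_pos, of candidate_cost] by (simp only: mult_1)
  then show "candidate_cost \<le> item_cost" "candidate_cost \<le> node_cost" "300 * n \<le> node_cost"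
    unfolding item_cost_def node_cost_def by linarith+
qed

lemma path_top: "path s \<Longrightarrow> level_ok s (regs s rDepth)"
  by (simp add: path_def)

lemma potential_bound:
  assumes "path s"
  shows "potential s \<le> node_cost + (if odd (regs s rDepth) then node_cost else 0)"
proof -
  let ?d = "regs s rDepth"
  have "(q - arrs s aNext ?d) * item_cost \<le> q * item_cost" by (intro mult_le_mono1) simp
  moreover have "length (bufs s ?d) * candidate_cost \<le> \<delta> V * candidate_cost"
    using path_top[OF assms] by (intro mult_le_mono1) (simp add: level_ok_def)
  ultimately show ?thesis unfolding potential_def node_cost_def Let_def by linarith
qed

lemma path_candidate:
  assumes p: "path s" and X: "X \<in> set (bufs s (regs s rDepth))"
  shows "X \<in> C" "X \<subseteq> level s (regs s rDepth)"
    "accepted s X \<Longrightarrow> X \<in> nodes"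
    "accepted s X \<Longrightarrow> card X + Suc (regs s rDepth) \<le> n + 1"
proof -
  let ?d = "regs s rDepth"
  have "X \<in> C \<and> X \<subseteq> level s ?d \<and> (accepted s X \<longrightarrow> X \<in> nodes \<and> card X + Suc ?d \<le> n + 1)"
  proof (cases "?d = 0")
    case True
    then have mc: "X \<in> max_components C V" using path_top[OF p] X by (simp add: level_ok_def)
    have "X \<in> nodes" if "accepted s X"
      using root_node[of X] that mc set_l2[OF V_ne] True by (auto simp: acceptable_def)
    then show ?thesis using mc True node_card[of X] by (auto simp: max_components_iff level_0)
  next
    case False
    let ?Y = "level s ?d" and ?j = "arrs s aNext ?d - 1"
    have Y: "?Y \<in> nodes" "card ?Y + ?d \<le> n + 1" "arrs s aNext ?d \<le> q" "arrs s aNext ?d \<ge> 1"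
      "X \<in> set (candidates ?Y ?j)" using path_top[OF p] X False by (simp_all add: level_ok_def)
    have j: "?j < q" using Y by simp
    note c = candidates_sub[OF Y(5) level_sub j]
    have "card X < card ?Y" using kid_card(1)[OF Y(1) c(2)] .
    moreover have "X \<in> nodes" if "accepted s X"
    proof (rule is_kid_node[OF c(1) _ j])
      show "is_kid ?Y ?j X" using that False by (simp add: acceptable_def)
    qed
    ultimately show ?thesis using c Y(2) by auto
  qed
  then show "X \<in> C" "X \<subseteq> level s ?d" "accepted s X \<Longrightarrow> X \<in> nodes"
    "accepted s X \<Longrightarrow> card X + Suc ?d \<le> n + 1" by auto
qed

definition same_path :: "'v state \<Rightarrow> 'v state \<Rightarrow> bool" where
  "same_path s s' \<longleftrightarrow> (\<forall>r\<le>4. regs s' r = regs s r) \<and>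
     (\<forall>a\<in>{aIncidence, aLevel, aNext}. arrs s' a = arrs s a) \<and> outs s' = outs s"

lemma same_path_simps:
  assumes "same_path s s'"
  shows "regs s' rNum = regs s rNum" "regs s' (Suc 0) = regs s (Suc 0)" "regs s' rDepth = regs s rDepth"
    "regs s' rParity = regs s rParity" "regs s' rRun = regs s rRun"
    "arrs s' aIncidence = arrs s aIncidence" "arrs s' aLevel = arrs s aLevel"
    "arrs s' aNext = arrs s aNext" "outs s' = outs s" "level s' = level s"
    "acceptable s' = acceptable s"
proof -
  show *: "level s' = level s" using assms by (intro level_cong) (simp add: same_path_def)
  show "acceptable s' = acceptable s"
    using assms by (intro ext) (simp add: same_path_def acceptable_def *)
qed (use assms in \<open>simp_all add: same_path_def\<close>)

text \<open>The filter in \<open>frame\<close> ignores \<open>X\<close> anyway, so the future output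
  is unchanged; the potential releases one \<open>candidate_cost\<close>.\<close>

lemma progress_reject:
  assumes p: "path s" and b: "bufs s (regs s rDepth) = X # Xs" and X: "\<not> accepted s X"
    and s': "same_path s s'" "bufs s' = (bufs s)(regs s rDepth := Xs)"
    and c: "clock s' \<le> clock s + candidate_cost"
  shows "progress s s'"
proof -
  let ?d = "regs s rDepth"
  note eqs = same_path_simps[OF s'(1)]
  have "level_ok s' e" if "e \<le> ?d" for e
  proof (rule level_ok_mono)
    show "level_ok s e" using p that by (simp add: path_def)
  qed (use b in \<open>auto simp: eqs s'(2)\<close>)
  then have "path s'" using p by (simp add: path_def base_def eqs s'(2))
  moreover have "frame s' ?d = frame s ?d" using b X by (simp add: frame_def rest_def eqs s'(2))
  then have "pending s' = pending s"
    unfolding pending_def eqs below_Suc using s'(2) eqs by (auto intro!: below_cong frame_cong)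
  moreover have "potential s = potential s' + candidate_cost"
    by (simp add: potential_def Let_def eqs s'(2) b)
  ultimately show ?thesis using c costs_pos(1) eqs by (simp add: progress_def)
qed

lemma progress_accept:
  assumes p: "path s" and b: "bufs s (regs s rDepth) = X # Xs" and X: "accepted s X"
    and s1: "same_path s s1" "bufs s1 = (bufs s)(regs s rDepth := Xs)" "clock s \<le> clock s1"
    and s': "pushed s1 X t s'" and c: "clock s' \<le> clock s + candidate_cost"
  shows "progress s s'"
proof -
  let ?d = "regs s rDepth"
  note e1 = same_path_simps[OF s1(1)]
  note r = s'[unfolded pushed_def e1 s1(2)]
  have XC: "X \<in> nodes" "card X + Suc ?d \<le> n + 1" using path_candidate[OF p, of X] b X by auto
  have d: "?d < n" using XC(2) node_card(1)[OF XC(1)] by simp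
  have dp: "?d mod 2 = regs s rParity" using p by (simp add: path_def base_def)
  have lev: "level s' e = level s e" if "e \<le> ?d" for e using r that by simp
  have nxt: "arrs s' aNext e = arrs s aNext e" if "e \<le> ?d" for e using r that by simp
  have top: "level s' (Suc ?d) = X" "arrs s' aNext (Suc ?d) = 0" "bufs s' (Suc ?d) = []"
    using r p by (simp_all add: path_def)
  have "base s'" using r p d by (simp add: base_def path_def mod_Suc_eq_one e1)
  moreover have "level_ok s' e" if le: "e \<le> Suc ?d" for e
  proof -
    consider "e \<le> ?d" | "e = Suc ?d" using le by linarith
    then show ?thesis
    proof cases
      case 1
      then have "level_ok s e" using p by (simp add: path_def)
      then show ?thesis
        by (rule level_ok_mono) (use lev[OF 1] nxt[OF 1] r b 1 in auto)
    next
      case 2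
      then show ?thesis using top XC by (simp add: level_ok_def)
    qed
  qed
  moreover have "\<forall>e>Suc ?d. bufs s' e = []" using r p by (simp add: path_def)
  ultimately have "path s'" using r by (simp add: path_def)
  \<comment> \<open>Unfolding one unit of fuel turns the listing of \<open>X\<close> into its
    immediate output, if any, followed by the frame of the new top level.\<close>
  have nd: "n - ?d = Suc (n - Suc ?d)" using d by simp
  have sub: "subtree (n - ?d) (even ?d) X = (if even ?d then [X] else []) @ frame s' (Suc ?d)"
    unfolding nd subtree.simps frame_def rest_def top by simp
  have "frame s ?d = subtree (n - ?d) (even ?d) X @ frame s' ?d"
    using b X r acceptable_cong[OF lev[of ?d] nxt[of ?d]] lev[of ?d] nxt[of ?d]
    by (simp add: frame_def rest_def)
  moreover have "below s' ?d = below s ?d"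
    using lev nxt r by (intro below_cong frame_cong) auto
  ultimately have pend: "pending s = (if even ?d then [X] else []) @ pending s'"
    using r sub by (simp add: pending_def below_Suc)
  have pot: "potential s' = q * item_cost + 300 * n + (if even ?d then node_cost else 0)"
    using r top by (simp add: potential_def Let_def)
  have pot_s: "candidate_cost + 300 * n + (if odd ?d then node_cost else 0) \<le> potential s"
    using b by (simp add: potential_def Let_def)
  show ?thesis
  proof (cases "even ?d")
    case True
    then have "regs s rParity = 0" using dp by auto
    then have "outs s' = outs s @ [(t, X)]" "pending s = X # pending s'"
      "clock s \<le> t" "t \<le> clock s'" using r s1(3) pend True by auto
    moreover have "t \<le> clock s + potential s" using \<open>t \<le> clock s'\<close> c pot_s by simp
    moreover have "clock s' + potential s' \<le> t + max_delay"
      using c \<open>clock s \<le> t\<close> pot True by (simp add: max_delay_def node_cost_def)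
    ultimately show ?thesis using \<open>path s'\<close> unfolding progress_def by blast
  next
    case False
    \<comment> \<open>The spare \<open>node_cost\<close> in the potential at odd depth pays for the
      child, whose potential at even depth contains no spare.\<close>
    then have "regs s rParity \<noteq> 0" using dp by (simp add: odd_iff_mod_2_eq_one)
    then have "outs s' = outs s" "pending s' = pending s" using r pend False by auto
    moreover have "clock s' + potential s' \<le> clock s + potential s" "potential s' < potential s"
      using c pot pot_s False costs_pos(1) by (simp_all add: node_cost_def)
    ultimately show ?thesis using \<open>path s'\<close> unfolding progress_def by blast
  qed
qed

lemma progress_item:
  assumes p: "path s" and d: "regs s rDepth = d" and b: "bufs s d = []"
    and j: "arrs s aNext d = j" "j < q"
    and s': "\<And>r. r \<le> 4 \<Longrightarrow> regs s' r = regs s r" "arrs s' aIncidence = arrs s aIncidence"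
      "arrs s' aLevel = arrs s aLevel" "arrs s' aNext = (arrs s aNext)(d := Suc j)"
      "bufs s' = (bufs s)(d := candidates (level s d) j)" "outs s' = outs s"
    and c: "clock s' \<le> clock s + t2 + 300 * n"
  shows "progress s s'"
proof -
  have d1: "d \<ge> 1" using path_top[OF p] j d by (cases d) (simp_all add: level_ok_def)
  have lev: "level s' = level s" using s'(3) by (rule level_cong)
  note eqs = s'(1)[of 0] s'(1)[of "Suc 0"] s'(1)[of 2] s'(1)[of 3] s'(1)[of 4] s'(2-6) lev d
  have len: "length (candidates (level s d) j) \<le> \<delta> V" by (rule length_candidates[OF level_sub])
  have "level_ok s' d" using path_top[OF p] d d1 j len by (simp add: level_ok_def eqs)
  moreover have "level_ok s' e" if "e < d" for e
  proof (rule level_ok_mono)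
    show "level_ok s e" using p that d by (simp add: path_def)
  qed (use that in \<open>simp_all add: eqs\<close>)
  moreover have "base s'" using p by (simp add: path_def base_def eqs)
  ultimately have "path s'" using p d by (auto simp: path_def eqs le_less)
  \<comment> \<open>With the pointer advanced, acceptable candidates are the children for item
    \<open>j\<close>: the first block of \<open>rest\<close> moves into the buffer.\<close>
  moreover have "acceptable s' d = is_kid (level s d) j"
    using d1 by (simp add: acceptable_def fun_eq_iff eqs)
  then have "frame s' d = frame s d"
    using d1 b j by (simp add: frame_def rest_def eqs upt_conv_Cons)
  moreover have "below s' d = below s d" by (intro below_cong frame_cong) (simp_all add: eqs)
  ultimately have "path s'" "pending s' = pending s" by (simp_all add: pending_def below_Suc eqs)
  \<comment> \<open>One \<open>item_cost\<close> is traded for the oracle call and the price of all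
    candidates returned.\<close>
  moreover have "potential s' + t2 + 300 * n \<le> potential s"
  proof -
    have "q - j = Suc (q - Suc j)" using j by simp
    moreover have "length (candidates (level s d) j) * candidate_cost \<le> \<delta> V * candidate_cost"
      using len by (rule mult_le_mono1)
    ultimately have "(q - Suc j) * item_cost + length (candidates (level s d) j) * candidate_cost + t2 + 300 * n
        \<le> (q - j) * item_cost" unfolding item_cost_def by (simp only: mult_Suc)
    then show ?thesis using b j by (simp add: potential_def Let_def eqs)
  qed
  ultimately show ?thesis using c s'(6) n_pos by (simp add: progress_def)
qed

lemma progress_pop:
  assumes p: "path s" and d: "regs s rDepth = d" "d > 0" and b: "bufs s d = []"
    and j: "arrs s aNext d \<ge> q"
    and s': "\<And>r. r \<in> {rNum, rItems, rRun} \<Longrightarrow> regs s' r = regs s r"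
      "regs s' rDepth = d - 1" "regs s' rParity = (d - 1) mod 2"
      "\<And>a. a \<in> {aIncidence, aLevel, aNext} \<Longrightarrow> arrs s' a = arrs s a" "bufs s' = bufs s"
      "clock s \<le> t" "t \<le> clock s'" "outs s' = outs s @ (if even d then [(t, level s d)] else [])"
    and c: "clock s' \<le> clock s + 300 * n"
  shows "progress s s'"
proof -
  obtain e where e: "d = Suc e" using d by (cases d) auto
  have lev: "level s' = level s" using s'(4) by (intro level_cong) simp
  note eqs = s'(1)[of 0] s'(1)[of "Suc 0"] s'(1)[of 4] s'(2,3) s'(4)[of 0] s'(4)[of 5] s'(4)[of 6] s'(5) lev
  have "base s'" using p e d by (simp add: path_def base_def eqs)
  moreover have "level_ok s' k" if "k \<le> e" for k
  proof (rule level_ok_mono)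
    show "level_ok s k" using p that d e by (simp add: path_def)
  qed (simp_all add: eqs)
  moreover have "bufs s' k = []" if "k > e" for k
    using that p b d e s'(5) by (cases "k = d") (simp_all add: path_def)
  ultimately have "path s'" using p e d s'(2) by (simp add: path_def)
  have nxt: "arrs s aNext d = q" using path_top[OF p] j d by (simp add: level_ok_def)
  have "frame s d = (if even d then [level s d] else [])"
    using b nxt d(2) by (simp add: frame_def rest_def)
  moreover have "below s' d = below s d" by (intro below_cong frame_cong) (simp_all add: eqs)
  ultimately have pend: "pending s = (if even d then [level s d] else []) @ pending s'"
    using e d by (simp add: pending_def below_Suc eqs)
  have pot: "potential s = 300 * n + (if odd d then node_cost else 0)"
    using b nxt d by (simp add: potential_def Let_def)
  have pot': "potential s' \<le> node_cost + (if even d then node_cost else 0)"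
    using potential_bound[OF \<open>path s'\<close>] e s'(2) by simp
  show ?thesis
  proof (cases "even d")
    case True
    then have "outs s' = outs s @ [(t, level s d)]" "pending s = level s d # pending s'"
      using s' pend by simp_all
    moreover have "t \<le> clock s + potential s" using s'(7) c pot by simp
    moreover have "clock s' + potential s' \<le> t + max_delay"
      using c s'(6) pot' True by (simp add: max_delay_def)
    ultimately show ?thesis using \<open>path s'\<close> s'(6,7) unfolding progress_def by blast
  next
    case False
    \<comment> \<open>Leaving an odd depth is silent; its spare \<open>node_cost\<close> becomes the
      whole budget of the level returned to, at even depth.\<close>
    then have "outs s' = outs s" "pending s' = pending s" using s' pend by simp_all
    moreover have "clock s' + potential s' \<le> clock s + potential s" "potential s' < potential s"
      using c pot pot' False n_pos by simp_all
    ultimately show ?thesis using \<open>path s'\<close> unfolding progress_def by blast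
  qed
qed

text \<open>The start in \<open>tick 2 s\<close> accounts for the loop condition, so that
  \<open>progress\<close> compares whole rounds.\<close>

lemma wp_step:
  assumes p: "path s"
  shows "wp M step (progress s) (tick 2 s)"
proof -
  let ?d = "regs s rDepth"
  have b: "regs s rNum = n" "regs s rItems = q" "?d \<le> n" "regs s rParity = ?d mod 2"
    "incidence (arrs s aIncidence)" "\<And>i. i < n \<Longrightarrow> arrs s aLevel i \<le> n"
    using p by (simp_all add: path_def base_def)
  show ?thesis unfolding step_def
  proof (rule wp_Seq, rule wp_Fetch, goal_cases)
    case 3
    then have empty: "bufs s ?d = []" by (simp add: tick_def)
    define s1 where "s1 = tick (1 + cost (Reg rDepth)) (set_reg rFetched 0 (tick 2 s))"
    have s1: "\<And>r. r \<noteq> rFetched \<Longrightarrow> regs s1 r = regs s r" "regs s1 rFetched = 0" "arrs s1 = arrs s"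
      "bufs s1 = bufs s" "outs s1 = outs s" "clock s1 = clock s + 4"
      by (simp_all add: s1_def state_defs)
    have lev1: "level s1 = level s" by (rule level_cong) (simp add: s1)
    have "wp M (If (Reg rFetched) try_candidate (If (Bin Less next_index (Reg rItems)) next_item pop))
        (progress s) s1"
    proof (rule wp_If, goal_cases)
      case 3
      let ?s2 = "tick (1 + cost (Reg rFetched)) s1"
      show ?case
      proof (rule wp_If, goal_cases)
        case 2
        let ?s3 = "tick (1 + cost (Bin Less next_index (Reg rItems))) ?s2"
        have j: "arrs s aNext ?d < q" using 2 s1 b by (simp add: tick_def split: if_splits)
        have lev3: "level ?s3 = level s" using lev1 by (simp add: level_def tick_def fun_eq_iff)
        show ?case
        proof (rule wp_next_item[where d = ?d and j = "arrs s aNext ?d"], goal_cases)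
          case (9 s')
          show ?case
            by (rule progress_item[OF p refl empty refl j])
              (use 9 s1 lev3 n_pos in \<open>simp_all add: tick_def\<close>)
        qed (use s1 b j empty in \<open>simp_all add: tick_def\<close>)
      next
        case 3
        let ?s3 = "tick (1 + cost (Bin Less next_index (Reg rItems))) ?s2"
        have j: "arrs s aNext ?d \<ge> q" using 3 s1 b by (simp add: tick_def split: if_splits)
        have lev3: "level ?s3 = level s" using lev1 by (simp add: level_def tick_def fun_eq_iff)
        show ?case
        proof (cases "?d = 0")
          case True
          have "pending s = []"
            using True empty by (simp add: pending_def below_def frame_def rest_def)
          moreover have "potential s \<ge> 300 * n" by (simp add: potential_def Let_def)
          ultimately show ?thesis unfolding pop_def using True s1 n_pos
            by (intro wp_If wp_Assign) (simp_all add: state_defs progress_def)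
        next
          case False
          show ?thesis
          proof (rule wp_pop[where d = ?d], goal_cases)
            case (6 s' t)
            show ?case
              by (rule progress_pop[OF p refl _ empty j, where t = t])
                (use 6 s1 lev3 n_pos False in \<open>auto simp: tick_def\<close>)
          qed (use s1 b False in \<open>simp_all add: tick_def\<close>)
        qed
      qed (use s1 b in \<open>simp_all add: tick_def\<close>)
    qed (use s1 in simp_all)
    then show ?case by (simp only: s1_def)
  next
    case (4 X Xs)
    then have buf: "bufs s ?d = X # Xs" by (simp add: tick_def)
    note c = path_candidate[OF p, of X, unfolded buf]
    define s1 where "s1 = tick (1 + cost (Reg rFetched)) (tick (1 + cost (Reg rDepth) + num M)
       (set_reg rFetched 1 (set_buf (val (tick 2 s) (Reg rDepth)) Xs (set_vec M aCandidate X (tick 2 s)))))"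
    have s1: "same_path s s1" "bufs s1 = (bufs s)(?d := Xs)" "bits (arrs s1 aCandidate) X"
       "clock s1 = clock s + 6 + n"
      by (simp_all add: s1_def state_defs bits_encode same_path_def)
    note e1 = same_path_simps[OF s1(1)]
    have "wp M try_candidate (progress s) s1"
    proof (rule wp_try_candidate[where X = X], goal_cases)
      case 10
      then show ?case using c e1 node_card[of X] by simp
    next
      case (11 s')
      have "same_path s1 s'" using 11(1) by (simp add: agree_def same_path_def)
      then have "same_path s s'" using s1(1) by (simp add: same_path_def)
      then show ?case
        by (rule progress_reject[OF p buf, rotated])
          (use 11 s1 e1 n_pos in \<open>simp_all add: agree_def candidate_cost_def\<close>)
    next
      case (12 t s')
      show ?case
        by (rule progress_accept[OF p buf _ s1(1,2) _ 12(1)])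
          (use 12 s1 e1 n_pos in \<open>simp_all add: candidate_cost_def\<close>)
    qed (use b s1 e1 c in simp_all)
    then show ?case by (intro wp_If) (simp_all add: s1_def set_reg_def tick_def)
  qed (use b in \<open>simp_all add: tick_def\<close>)
qed

section \<open>From single steps to the delay of the whole run\<close>

definition start_cost :: nat where
  "start_cost = t2 + 120 * n"

text \<open>The default 0 makes the time up to the first output count as a gap.\<close>

definition last_time :: "'v state \<Rightarrow> nat" where
  "last_time s = last (0 # map fst (outs s))"

definition gaps :: "nat list \<Rightarrow> nat set" where
  "gaps ts = set (map2 (-) ts (0 # ts))"

lemma set_gaps_snoc:
  "set (map2 (-) (ts @ [T]) (a # ts)) = insert (T - last (a # ts)) (set (map2 (-) ts (a # ts)))"
  for ts :: "nat list"
  by (induction ts arbitrary: a) auto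

lemma delay_le_iff: "delay ts T \<le> D \<longleftrightarrow> T - last (0 # ts) \<le> D \<and> (\<forall>x\<in>gaps ts. x \<le> D)"
  unfolding delay_def set_gaps_snoc gaps_def by (subst Max_le_iff) auto

text \<open>The last conjunct carries the delay bound: time plus potential never exceeds the
  deadline for the next output or for halting.\<close>

definition main_inv :: "'v state \<Rightarrow> bool" where
  "main_inv s \<longleftrightarrow> (regs s rRun \<noteq> 0 \<longrightarrow> path s) \<and>
     map snd (outs s) @ (if regs s rRun = 0 then [] else pending s) = traversal \<and>
     (\<forall>x\<in>gaps (map fst (outs s)). x \<le> max_delay + start_cost) \<and> last_time s \<le> clock s \<and>
     clock s + (if regs s rRun = 0 then 2 else potential s) \<le> last_time s + max_delay + start_cost"

text \<open>Lexicographic in the outputs still due and the potential. The \<open>Suc\<close> lets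
  the halting step decrease as well, although nothing is pending by then.\<close>

definition variant :: "('v state \<times> 'v state) set" where
  "variant = measures [\<lambda>s. if regs s rRun = 0 then 0 else Suc (length (pending s)), potential]"

lemma path_run: "path s \<Longrightarrow> regs s rRun = 1"
  by (simp add: path_def base_def)

lemma main_inv_progress:
  assumes J: "main_inv s" "regs s rRun \<noteq> 0" and pr: "progress s s'" and c: "clock s \<le> clock s'"
  shows "main_inv s' \<and> (s', s) \<in> variant"
proof -
  have p: "path s" using J by (simp add: main_inv_def)
  note J' = J(1)[unfolded main_inv_def] path_run[OF p]
  consider (silent) "path s'" "outs s' = outs s" "pending s' = pending s"
       "clock s' + potential s' \<le> clock s + potential s" "potential s' < potential s"
    | (out) t X where "path s'" "outs s' = outs s @ [(t, X)]" "pending s = X # pending s'"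
       "clock s \<le> t" "t \<le> clock s + potential s" "t \<le> clock s'"
       "clock s' + potential s' \<le> t + max_delay"
    | (stop) "regs s' rRun = 0" "outs s' = outs s" "pending s = []" "clock s' + 2 \<le> clock s + potential s"
    using pr unfolding progress_def by (elim disjE exE conjE) (rule that; assumption)+
  then show ?thesis
  proof cases
    case silent
    then show ?thesis using J' path_run[OF silent(1)] c
      by (simp add: main_inv_def variant_def last_time_def)
  next
    case out
    have "gaps (map fst (outs s')) = insert (t - last_time s) (gaps (map fst (outs s)))"
    proof -
      \<comment> \<open>\<open>zip\<close> stops at the shorter list, so the additional last time in
        the second one is ignored.\<close>
      have "zip (ts @ [t]) (0 # ts @ [t]) = zip (ts @ [t]) (0 # ts)" for ts :: "nat list"
        using zip_append1[of "ts @ [t]" "[]"] zip_append[of "ts @ [t]" "0 # ts" "[]" "[t]"] by simp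
      then show ?thesis using set_gaps_snoc[of "map fst (outs s)" t 0]
        by (simp add: gaps_def last_time_def out(2))
    qed
    moreover have "clock s + potential s \<le> last_time s + max_delay + start_cost" using J' by simp
    then have "t - last_time s \<le> max_delay + start_cost" using out(5) by linarith
    moreover have "last_time s' = t" by (simp add: last_time_def out(2))
    ultimately show ?thesis using J' out path_run[OF out(1)]
      by (simp add: main_inv_def variant_def)
  next
    case stop
    then show ?thesis using J' c by (simp add: main_inv_def variant_def last_time_def)
  qed
qed

lemma exec_clock: "exec M' c s s' \<Longrightarrow> clock s \<le> clock s'"
  by (induction rule: exec.induct) (auto simp: state_defs)

lemma wp_main:
  assumes "main_inv s"
  shows "wp M (While (Reg rRun) step) (\<lambda>s'. map snd (outs s') = traversal \<and>
    delay (map fst (outs s')) (clock s') \<le> max_delay + start_cost) s"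
proof (rule wp_While_wf[where R = variant and J = main_inv], goal_cases)
  case (3 s)
  have "wp M step (\<lambda>s'. main_inv s' \<and> (s', s) \<in> variant) (tick 2 s)" if run: "regs s rRun \<noteq> 0"
  proof -
    have "path s" using 3 run by (simp add: main_inv_def)
    then obtain s' where s': "exec M step (tick 2 s) s'" "progress s s'"
      using wp_step by (auto simp: wp_def)
    have "clock s \<le> clock s'" using exec_clock[OF s'(1)] by (simp add: tick_def)
    then show ?thesis using s' main_inv_progress[OF 3 run s'(2)] by (auto simp: wp_def)
  qed
  moreover have "delay (map fst (outs s)) (clock s + 2) \<le> max_delay + start_cost" if "regs s rRun = 0"
    using 3 that by (auto simp: delay_le_iff main_inv_def last_time_def)
  ultimately show ?case using 3 by (auto simp: main_inv_def tick_def)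
qed (simp_all add: variant_def assms)

text \<open>The only frame, at depth 0, lists the trees over the good sets in the buffer, which is
  \<open>traversal\<close>; \<open>start_cost\<close> covers the time before the loop.\<close>

lemma main_inv_start:
  assumes "regs s rNum = n" "regs s rItems = q" "regs s rDepth = 0" "regs s rParity = 0"
    "regs s rRun = 1" "incidence (arrs s aIncidence)" "arrs s aLevel = (\<lambda>_. 0)"
    "arrs s aNext 0 = q" "bufs s = (\<lambda>_. [])(0 := l2 V)" "outs s = []" "clock s \<le> start_cost"
  shows "main_inv s"
proof -
  have p: "path s" using assms length_l2[OF V_ne] set_l2[OF V_ne]
    by (simp add: path_def base_def level_ok_def)
  have "acceptable s 0 = good" by (simp add: acceptable_def fun_eq_iff)
  then have "pending s = traversal"
    using assms by (simp add: pending_def below_def frame_def rest_def traversal_def)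
  moreover have "potential s \<le> max_delay"
    using potential_bound[OF p] assms(3) by (simp add: max_delay_def)
  ultimately show ?thesis using p assms(5,10,11)
    by (simp add: main_inv_def last_time_def gaps_def)
qed

lemma input_incidence: "incidence (arrs (input_state M q item \<sigma>) aIncidence)"
  using index_less q_pos by (auto simp: incidence_def input_state_def)

lemma enumerate_correct:
  "enumerates_with_delay enumeration M (input_state M q item \<sigma>) nodes (max_delay + start_cost)"
proof -
  let ?s = "input_state M q item \<sigma>"
  have i: "regs ?s rNum = n" "regs ?s rItems = q" "regs ?s rDepth = 0" "regs ?s rParity = 0"
    "arrs ?s aLevel = (\<lambda>_. 0)" "bufs ?s = (\<lambda>_. [])" "clock ?s = 0" "outs ?s = []"
    by (simp_all add: input_state_def fun_eq_iff)
  have "wp M enumeration (\<lambda>s'. map snd (outs s') = traversal \<and>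
      delay (map fst (outs s')) (clock s') \<le> max_delay + start_cost) ?s"
    unfolding enumeration_def
  proof (rule wp_Seq, rule wp_scan_M[where f = "\<lambda>_. 0" and g = "\<lambda>_. 1"], goal_cases)
    case (4 t)
    define s1 where "s1 = scanned n aSupport (\<lambda>_. 0) (\<lambda>_. 1) ?s t"
    have s1: "\<And>r. r \<le> 4 \<Longrightarrow> regs s1 r = regs ?s r" "\<And>a. a \<noteq> aSupport \<Longrightarrow> arrs s1 a = arrs ?s a"
      "bufs s1 = bufs ?s" "clock s1 = t" "outs s1 = []" "bits (arrs s1 aSupport) V"
      using i(8) by (auto simp: s1_def scanned_def bits_def el_V)
    have dec: "decode M (arrs s1 aSupport) = V" using decode_bits[OF s1(6)] by simp
    have "wp M (Seq (CallL2 (Num 0) aSupport) (Seq (Store aNext (Num 0) (Reg rItems))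
           (Seq (Assign rRun (Num 1)) (While (Reg rRun) step))))
       (\<lambda>s'. map snd (outs s') = traversal \<and>
        delay (map fst (outs s')) (clock s') \<le> max_delay + start_cost) s1"
    proof (intro wp_Seq wp_CallL2 wp_Store wp_Assign wp_main, goal_cases)
      case 8
      show ?case
        by (rule main_inv_start) (use s1 i dec input_incidence 4 n_pos in \<open>simp_all add: state_defs start_cost_def\<close>)
    qed (use s1 i dec V_ne in \<open>simp_all add: state_defs\<close>)
    then show ?case by (simp only: s1_def)
  qed (use i in simp_all)
  then show ?thesis
    using set_traversal distinct_traversal unfolding wp_def enumerates_with_delay_def by metis
qed

lemma delay_bound:
  "max_delay + start_cost \<le> 10000 * ((n + q) * q * \<delta> V * t1 + q * t2 + q * \<delta> V * t\<rho>
     + (n ^ 2 + n * q) * q * \<delta> V)"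
proof -
  define D where "D = q * \<delta> V"
  define A where "A = (n + q) * q * \<delta> V * t1"
  define E where "E = (n ^ 2 + n * q) * q * \<delta> V"
  define K where "K = D * candidate_cost"
  have D: "1 \<le> D" "q \<le> D" "\<delta> V \<le> D"
    using q_pos \<delta>_pos mult_le_mono[OF q_pos \<delta>_pos] by (simp_all add: D_def)
  \<comment> \<open>The dominant terms: \<open>q\<close> items, \<open>\<delta> V\<close> candidates
    each and \<open>q\<close> rounds of the scan per candidate multiply to \<open>q * D\<close>,
    once with an oracle call and once with \<open>n\<close> own steps per round.\<close>
  have qq: "q * (D * t1) \<le> A"
    unfolding A_def D_def by (simp add: algebra_simps)
  have one: "x \<le> q * x" for x using mult_le_mono1[OF q_pos, of x] by simp
  have qn: "q * (D * n) \<le> E"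
    unfolding E_def D_def by (simp add: algebra_simps)
  have t1: "D * t1 \<le> A" using qq one[of "D * t1"] by linarith
  have n1: "D * n \<le> E" using qn one[of "D * n"] by linarith
  have nq: "q * n \<le> E" "n \<le> E"
    using n1 mult_le_mono1[OF D(2), of n] one[of n] by linarith+
  have "K = q * (D * t1) + 350 * (q * (D * n)) + D * t1 + D * t\<rho> + 600 * (D * n)"
    unfolding K_def candidate_cost_def by (simp add: algebra_simps)
  then have K: "K \<le> 2 * A + 950 * E + D * t\<rho>" using qq qn t1 n1 by linarith
  have k: "candidate_cost \<le> K" "\<delta> V * candidate_cost \<le> K"
    unfolding K_def using mult_le_mono1[OF D(1), of candidate_cost] mult_le_mono1[OF D(3), of candidate_cost]
    by simp_all
  have "q * item_cost = q * t2 + 300 * (q * n) + K"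
    unfolding item_cost_def K_def D_def by (simp add: algebra_simps)
  then have "node_cost \<le> q * t2 + 600 * E + 2 * K"
    unfolding node_cost_def using nq k by linarith
  \<comment> \<open>Here 1620 is \<open>2 * 600 + 300 + 120\<close> and 5 is
    \<open>2 * 2 + 1\<close>; with the bound on \<open>K\<close> all coefficients stay below
    10000.\<close>
  then have "max_delay + start_cost \<le> 3 * (q * t2) + 1620 * E + 5 * K"
    unfolding max_delay_def start_cost_def using nq k one[of t2] by linarith
  also have "\<dots> \<le> 10000 * (A + q * t2 + D * t\<rho> + E)"
  proof -
    have "K \<le> 2 * a + 950 * e + y \<Longrightarrow> 3 * x + 1620 * e + 5 * K \<le> 10000 * (a + x + y + e)"
      for a e x y :: nat by (simp add: distrib_left)
    then show ?thesis using K .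
  qed
  finally show ?thesis unfolding A_def D_def E_def .
qed

end

theorem theorem1:
  "\<exists>(P :: com) (c :: nat).
     \<forall>(V :: 'v set) (C :: 'v set set) (I :: 'i set) (\<sigma> :: 'v \<Rightarrow> 'i set)
      (\<rho> :: 'v set \<Rightarrow> real) (\<delta> :: 'v set \<Rightarrow> nat)
      (l1 :: 'v set \<Rightarrow> 'v set \<Rightarrow> 'v set) (l2 :: 'v set \<Rightarrow> 'v set list)
      (n :: nat) (q :: nat) (el :: nat \<Rightarrow> 'v) (item :: nat \<Rightarrow> 'i)
      (\<theta>1t :: nat) (\<theta>1s :: nat) (\<theta>2t :: nat) (\<theta>2s :: nat) (\<theta>\<rho>t :: nat) (\<theta>\<rho>s :: nat).
       is_instance V C I \<sigma> \<and> n = card V \<and> q = card I \<and>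
       bij_betw el {..<n} V \<and> bij_betw item {..<q} I \<and>
       is_L1 V C l1 \<and> is_L2 V C l2 \<and>
       volume_function V \<rho> \<and> component_bound V C \<delta> \<and> \<delta> V \<ge> 1
       \<longrightarrow> (\<exists>(cap :: nat) (nb :: nat) (w :: nat) (M :: 'v machine).
             M = \<lparr>num = n, elem = el, oracle1 = l1, oracle2 = l2, positive = (\<lambda>X. \<rho> X > 0),
                  time1 = \<theta>1t, time2 = \<theta>2t, time_pos = \<theta>\<rho>t,
                  capacity = cap, num_bufs = nb, max_word = w\<rparr> \<and>
             input_fits M q \<and>
             w \<le> c * ((n + q) * n) \<and>
             enumerates_with_delay P M (input_state M q item \<sigma>)
               {X \<in> solutions C I \<sigma>. \<rho> X > 0 \<and> X \<noteq> {}}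
               (c * ((n + q) * q * \<delta> V * \<theta>1t + q * \<theta>2t + q * \<delta> V * \<theta>\<rho>t
                     + (n ^ 2 + n * q) * q * \<delta> V)) \<and>
             space P M \<theta>1s \<theta>2s \<theta>\<rho>s
               \<le> c * (n * \<theta>1s + n * \<theta>2s + n * \<theta>\<rho>s + (n + q) * n))"
proof -
  \<comment> \<open>The program text is fixed, so its numbers of registers and arrays are constants;
    \<open>c\<close> absorbs them together with the factor of the delay.\<close>
  define r where "r = card ({0, 1} \<union> com_regs enumeration)"
  define a where "a = card (insert 0 (com_arrs enumeration))"
  define c where "c = 10000 + r + a"
  have main: "\<exists>cap nb w M.
             M = \<lparr>num = n, elem = el, oracle1 = l1, oracle2 = l2, positive = (\<lambda>X. \<rho> X > 0),
                  time1 = \<theta>1t, time2 = \<theta>2t, time_pos = \<theta>\<rho>t,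
                  capacity = cap, num_bufs = nb, max_word = w\<rparr> \<and>
             input_fits M q \<and>
             w \<le> c * ((n + q) * n) \<and>
             enumerates_with_delay enumeration M (input_state M q item \<sigma>)
               {X \<in> solutions C I \<sigma>. \<rho> X > 0 \<and> X \<noteq> {}}
               (c * ((n + q) * q * \<delta> V * \<theta>1t + q * \<theta>2t + q * \<delta> V * \<theta>\<rho>t
                     + (n ^ 2 + n * q) * q * \<delta> V)) \<and>
             space enumeration M \<theta>1s \<theta>2s \<theta>\<rho>s
               \<le> c * (n * \<theta>1s + n * \<theta>2s + n * \<theta>\<rho>s + (n + q) * n)"
    if inst: "is_instance V C I \<sigma>" "n = card V" "q = card I"
       "bij_betw el {..<n} V" "bij_betw item {..<q} I" "is_L1 V C l1" "is_L2 V C l2"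
       "volume_function V \<rho>" "component_bound V C \<delta>" "\<delta> V \<ge> 1"
    for V :: "'v set" and C and I :: "'i set" and \<sigma> \<rho> \<delta> l1 l2 n q el item \<theta>1t \<theta>1s \<theta>2t \<theta>2s \<theta>\<rho>t \<theta>\<rho>s
  proof -
    interpret oracle_machine V C I \<sigma> \<rho> \<delta> l1 l2 n q el item \<theta>1t \<theta>2t \<theta>\<rho>t
      using inst by unfold_locales
    let ?N = "(n + q) * n"
    let ?T = "(n + q) * q * \<delta> V * \<theta>1t + q * \<theta>2t + q * \<delta> V * \<theta>\<rho>t + (n ^ 2 + n * q) * q * \<delta> V"
    have "10000 * ?T \<le> c * ?T" by (rule mult_le_mono1) (simp add: c_def)
    then have "max_delay + start_cost \<le> c * ?T" using delay_bound by (rule order_trans[rotated])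
    then have "enumerates_with_delay enumeration M (input_state M q item \<sigma>) nodes (c * ?T)"
      using enumerate_correct unfolding enumerates_with_delay_def by (meson order_trans)
    moreover have "input_fits M q"
      using size_bound by (simp add: input_fits_def less_imp_le) (simp add: M_def)
    moreover have "2 * ?N \<le> c * ?N" by (rule mult_le_mono1) (simp add: c_def)
    moreover have "space enumeration M \<theta>1s \<theta>2s \<theta>\<rho>s \<le> c * (n * \<theta>1s + n * \<theta>2s + n * \<theta>\<rho>s + ?N)"
    proof -
      have one: "x \<le> n * x" for x using mult_le_mono1[OF n_pos, of x] by simp
      have "r \<le> r * ?N" using mult_le_mono2[of 1 ?N r] n_pos by simp
      \<comment> \<open>There are \<open>n + 1\<close> buffers; the extra one, like the space of the
        two oracles counted once, is absorbed using \<open>1 \<le> n\<close>.\<close>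
      moreover have "space enumeration M \<theta>1s \<theta>2s \<theta>\<rho>s = r + a * ?N + (n * \<theta>2s + \<theta>2s) + \<theta>1s + \<theta>\<rho>s"
        by (simp add: space_def r_def a_def M_def)
      ultimately have "space enumeration M \<theta>1s \<theta>2s \<theta>\<rho>s
          \<le> (r * ?N + a * ?N) + 2 * (n * \<theta>2s) + n * \<theta>1s + n * \<theta>\<rho>s"
        using one[of \<theta>1s] one[of \<theta>2s] one[of \<theta>\<rho>s] by linarith
      then have "space enumeration M \<theta>1s \<theta>2s \<theta>\<rho>s
          \<le> (r + a) * ?N + 2 * (n * \<theta>2s) + n * \<theta>1s + n * \<theta>\<rho>s"
        by (simp only: add_mult_distrib)
      also have "\<dots> \<le> c * ?N + c * (n * \<theta>2s) + c * (n * \<theta>1s) + c * (n * \<theta>\<rho>s)"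
        by (intro add_mono mult_le_mono1) (simp_all add: c_def)
      finally show ?thesis by (simp add: algebra_simps)
    qed
    ultimately show ?thesis unfolding M_def nodes_def by blast
  qed
  show ?thesis
    by (rule exI[of _ enumeration], rule exI[of _ c], intro allI impI, elim conjE, rule main)
qed

end
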